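(* Let $q=p^t$ be a power of an odd prime $p$, $t\geq1$, let $m\geq3$ be an integer (with $m\geq4$ if $q=3$), and let $n=q^m-1$. Then there exist asymmetric quantum codes with parameters (1) $[[tn,\ t(n-m(4q-5)-2),\ d_z\geq 2q+2\,/\,d_x\geq 2q]]_p$; (2) $[[tn,\ t(n-m(4q-c-5)-2),\ d_z\geq 2q+2\,/\,d_x\geq 2q-c]]_p$, for $0\leq c\leq q-2$; (3) $[[tn,\ t(n-m(2c-l-4)-2),\ d_z\geq c\,/\,d_x\geq c-l]]_p$, for $2\leq c\leq q$ and $0\leq l\leq c-2$; (4) $[[tn,\ t(n-m(2c-l-6)-2),\ d_z\geq c\,/\,d_x\geq c-l]]_p$, for $q+2<c\leq 2q$ and $0\leq l\leq c-q-3$; (5) $[[tn,\ t(n-m(4q-l-5)-1),\ d_z\geq 2q+1\,/\,d_x\geq 2q-l]]_p$, for $0\leq l\leq q-2$.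
   Context: An AQECC $[[n,k,d_z/d_x]]_p$ is a $p^k$-dimensional subspace of $\mathbb{C}^{p^n}$ correcting all qudit-flip errors up to $\lfloor (d_x-1)/2\rfloor$ and all phase-shift errors up to $\lfloor (d_z-1)/2\rfloor$; the notation $d_z\geq a/d_x\geq b$ means the code has such distances with $d_z\geq a$ and $d_x\geq b$. *)

theory Defs
  imports Complex_Main "HOL-Computational_Algebra.Primes"
begin

text \<open>Computational basis of (C^p)^{\<otimes>n}: words of length n over {0,..,p-1}.
  States are functions on words (vanishing outside), i.e. vectors of C^{p^n}.\<close>

definition words :: "nat \<Rightarrow> nat \<Rightarrow> nat list set" where
  "words n p = {w. length w = n \<and> set w \<subseteq> {..<p}}"

definition states :: "nat \<Rightarrow> nat \<Rightarrow> (nat list \<Rightarrow> complex) set" where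
  "states n p = {v. \<forall>w. w \<notin> words n p \<longrightarrow> v w = 0}"

definition inner_st :: "nat \<Rightarrow> nat \<Rightarrow> (nat list \<Rightarrow> complex) \<Rightarrow> (nat list \<Rightarrow> complex) \<Rightarrow> complex" where
  "inner_st n p u v = (\<Sum>w\<in>words n p. cnj (u w) * v w)"

definition wt :: "nat list \<Rightarrow> nat" where
  "wt a = length (filter (\<lambda>x. x \<noteq> 0) a)"

text \<open>Qudit-flip X(a): |x> \<mapsto> |x+a>, and phase shift Z(b): |x> \<mapsto> \<omega>^{b.x} |x>.\<close>

definition flipX :: "nat \<Rightarrow> nat \<Rightarrow> nat list \<Rightarrow> (nat list \<Rightarrow> complex) \<Rightarrow> (nat list \<Rightarrow> complex)" where
  "flipX n p a v = (\<lambda>w. if w \<in> words n p then v (map2 (\<lambda>x y. (x + p - y) mod p) w a) else 0)"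

definition phaseZ :: "nat \<Rightarrow> nat \<Rightarrow> nat list \<Rightarrow> (nat list \<Rightarrow> complex) \<Rightarrow> (nat list \<Rightarrow> complex)" where
  "phaseZ n p b v = (\<lambda>w. if w \<in> words n p
       then cis (2 * pi / real p) ^ (sum_list (map2 (*) b w)) * v w else 0)"

definition err_op :: "nat \<Rightarrow> nat \<Rightarrow> nat list \<Rightarrow> nat list \<Rightarrow> (nat list \<Rightarrow> complex) \<Rightarrow> (nat list \<Rightarrow> complex)" where
  "err_op n p a b = flipX n p a \<circ> phaseZ n p b"

definition subspace_dim :: "nat \<Rightarrow> nat \<Rightarrow> (nat list \<Rightarrow> complex) set \<Rightarrow> nat \<Rightarrow> bool" where
  "subspace_dim n p Q K \<longleftrightarrow>
     (\<exists>B :: nat \<Rightarrow> nat list \<Rightarrow> complex.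
        (\<forall>i<K. B i \<in> states n p) \<and>
        (\<forall>c :: nat \<Rightarrow> complex. (\<lambda>w. \<Sum>i<K. c i * B i w) = (\<lambda>w. 0) \<longrightarrow> (\<forall>i<K. c i = 0)) \<and>
        Q = {(\<lambda>w. \<Sum>i<K. c i * B i w) | c :: nat \<Rightarrow> complex. True})"

text \<open>Q corrects all errors X(a)Z(b) with wt a \<le> tx, wt b \<le> tz
  (Knill--Laflamme conditions).\<close>

definition corrects :: "nat \<Rightarrow> nat \<Rightarrow> (nat list \<Rightarrow> complex) set \<Rightarrow> nat \<Rightarrow> nat \<Rightarrow> bool" where
  "corrects n p Q tx tz \<longleftrightarrow>
     (\<forall>a1 b1 a2 b2.
        a1 \<in> words n p \<and> b1 \<in> words n p \<and> a2 \<in> words n p \<and> b2 \<in> words n p \<and>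
        wt a1 \<le> tx \<and> wt a2 \<le> tx \<and> wt b1 \<le> tz \<and> wt b2 \<le> tz \<longrightarrow>
        (\<exists>c::complex. \<forall>u\<in>Q. \<forall>v\<in>Q.
            inner_st n p (err_op n p a1 b1 u) (err_op n p a2 b2 v) = c * inner_st n p u v))"

definition AQECC :: "nat \<Rightarrow> nat \<Rightarrow> nat \<Rightarrow> nat \<Rightarrow> nat \<Rightarrow> (nat list \<Rightarrow> complex) set \<Rightarrow> bool" where
  "AQECC n k dz dx p Q \<longleftrightarrow>
     subspace_dim n p Q (p ^ k) \<and> corrects n p Q ((dx - 1) div 2) ((dz - 1) div 2)"

definition has_AQECC :: "nat \<Rightarrow> int \<Rightarrow> nat \<Rightarrow> nat \<Rightarrow> nat \<Rightarrow> bool" where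
  "has_AQECC n k a b p \<longleftrightarrow>
     (\<exists>kn::nat. int kn = k \<and> (\<exists>Q dz dx. AQECC n kn dz dx p Q \<and> dz \<ge> a \<and> dx \<ge> b))"

end

theory Submission
  imports Defs "HOL-Library.FuncSet" "HOL-Computational_Algebra.Polynomial"
begin

text \<open>A CSS code built from subgroups \<open>C2 \<subseteq> C1\<close> of the words corrects flips up to half the distance of
  \<open>C1\<close> and phase shifts up to half the distance of the dual of \<open>C2\<close>. Only the error radii
  \<open>(d - 1) div 2\<close> matter and a subspace of a code is a code, so inequalities between
  cardinalities suffice. Positions are the nonzero elements of the field of order \<open>q ^ m\<close>, and each
  symbol of the field of order \<open>q\<close> is expanded into \<open>t\<close> digits. \<open>C1\<close> is cut out by the power sums
  with exponents \<open>h, ..., h + r1\<close>, written in a basis of the field of order \<open>q\<close>; \<open>C2\<close> consists of the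
  traces, written in the dual basis, of the polynomials with exponents in \<open>e, ..., r2\<close>. The inclusion
  holds because the power sum over all nonzero field elements vanishes unless the exponent is
  divisible by \<open>n\<close>, and the BCH bound gives the distances. Exponents divisible by \<open>q\<close> are
  redundant, and a zero exponent costs one field element instead of \<open>m\<close>. Since \<open>0\<close> can occur only
  on one side, the other side uses exponents shifted by \<open>h = n div 2\<close>, for which the first one is
  just as cheap.\<close>

section \<open>Words and CSS codes\<close>

text \<open>No type can be indexed by the variables \<open>p\<close>, \<open>t\<close>,
  \<open>m\<close>, so the field of order \<open>p ^ (t * m)\<close> never appears as a type. All
  field arithmetic takes place in a commutative ring, in the end \<open>int poly\<close>, up to
  congruence \<open>\<approx>\<close> modulo a prime ideal, and residue classes are counted through
  the representatives chosen by \<open>rep\<close>. Linear algebra is replaced by counting: fibre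
  bounds stand in for ranks, and a map between finite sets of equal size is onto once it is
  injective. The exponents \<open>0\<close> and \<open>h = n div 2\<close> are cheap for the same
  reason: multiplication by \<open>q\<close> fixes them modulo \<open>n\<close>, so the power sum
  with such an exponent is fixed by the \<open>q\<close>-th power map and lies in the small field.
  For \<open>h\<close> this needs \<open>n dvd h * (q - 1)\<close>, which is where \<open>q\<close>
  being odd enters. In the dimension formulas the final \<open>- 1\<close> or \<open>- 2\<close>
  pays for these cheap exponents, and the multiple of \<open>m\<close> counts the other exponents
  not divisible by \<open>q\<close>. A phase distance of \<open>2 * q + 2\<close> costs only
  \<open>2 * q\<close> consecutive exponents, since \<open>2 * q + 1\<close> and
  \<open>2 * q + 2\<close> have the same error radius \<open>q\<close>.\<close>

definition word_add :: "nat \<Rightarrow> nat list \<Rightarrow> nat list \<Rightarrow> nat list" where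
  "word_add p = map2 (\<lambda>x y. (x + y) mod p)"

definition word_sub :: "nat \<Rightarrow> nat list \<Rightarrow> nat list \<Rightarrow> nat list" where
  "word_sub p = map2 (\<lambda>x y. (x + p - y) mod p)"

definition word_dot :: "nat list \<Rightarrow> nat list \<Rightarrow> nat" where
  "word_dot b w = sum_list (map2 (*) b w)"

section \<open>Arithmetic of words modulo \<open>p\<close>\<close>

lemma words_iff: "w \<in> words n p \<longleftrightarrow> length w = n \<and> (\<forall>i<n. w ! i < p)"
  by (fastforce simp: words_def in_set_conv_nth subset_iff)

lemma finite_words [simp]: "finite (words n p)"
proof -
  have "words n p = {w. set w \<subseteq> {..<p} \<and> length w = n}" by (auto simp: words_def)
  then show ?thesis by (simp add: finite_lists_length_eq)
qed

lemma card_words: "card (words n p) = p ^ n"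
proof -
  have "words n p = {w. set w \<subseteq> {..<p} \<and> length w = n}" by (auto simp: words_def)
  then show ?thesis by (simp add: card_lists_length_eq)
qed

lemma length_word_add [simp]: "length (word_add p u v) = min (length u) (length v)"
  and length_word_sub [simp]: "length (word_sub p u v) = min (length u) (length v)"
  by (simp_all add: word_add_def word_sub_def)

lemma nth_word_add [simp]:
  "i < length u \<Longrightarrow> i < length v \<Longrightarrow> word_add p u v ! i = (u ! i + v ! i) mod p"
  and nth_word_sub [simp]:
  "i < length u \<Longrightarrow> i < length v \<Longrightarrow> word_sub p u v ! i = (u ! i + p - v ! i) mod p"
  by (simp_all add: word_add_def word_sub_def)

lemma word_add_in_words: "p > 0 \<Longrightarrow> u \<in> words n p \<Longrightarrow> v \<in> words n p \<Longrightarrow> word_add p u v \<in> words n p"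
  and word_sub_in_words: "p > 0 \<Longrightarrow> u \<in> words n p \<Longrightarrow> v \<in> words n p \<Longrightarrow> word_sub p u v \<in> words n p"
  by (auto simp: words_iff)

lemma mod_sub_eq_iff:
  fixes x y z p :: nat
  assumes "x < p" "y < p" "z < p"
  shows "(x + p - y) mod p = z \<longleftrightarrow> x = (z + y) mod p"
proof -
  have "(x + p - y) mod p = (if y \<le> x then x - y else x + p - y)"
    using assms by (auto simp: mod_if)
  moreover have "(z + y) mod p = (if z + y < p then z + y else z + y - p)"
    using assms by (auto simp: mod_if)
  ultimately show ?thesis using assms by auto
qed

lemma word_sub_eq_iff:
  assumes "u \<in> words n p" "v \<in> words n p" "w \<in> words n p"
  shows "word_sub p u v = w \<longleftrightarrow> u = word_add p w v"
  using assms by (auto simp: words_iff list_eq_iff_nth_eq mod_sub_eq_iff)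

lemma word_sub_int_cong:
  assumes "u \<in> words n p" "v \<in> words n p" "i < n"
  shows "int p dvd int (word_sub p u v ! i) - (int (u ! i) - int (v ! i))"
proof -
  have "v ! i < p" "i < length u" "i < length v" using assms by (auto simp: words_iff)
  then have "int (word_sub p u v ! i) = (int (u ! i) + int p - int (v ! i)) mod int p"
    by (simp add: zmod_int of_nat_diff)
  then show ?thesis
    by (simp add: mod_eq_dvd_iff[symmetric] mod_simps) (metis add_diff_eq add.commute mod_add_self1)
qed

lemma word_add_int_cong:
  assumes "u \<in> words n p" "v \<in> words n p" "i < n"
  shows "int p dvd int (word_add p u v ! i) - (int (u ! i) + int (v ! i))"
  using assms by (auto simp: words_iff zmod_int mod_eq_dvd_iff[symmetric])

lemma word_add_sub_cancel:
  assumes "p > 0" "u \<in> words n p" "v \<in> words n p"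
  shows "word_add p (word_sub p u v) v = u" "word_sub p (word_add p u v) v = u"
  using word_sub_eq_iff[of u n p v "word_sub p u v"]
    word_sub_eq_iff[of "word_add p u v" n p v u] assms word_add_in_words word_sub_in_words by auto

lemma word_add_commute: "word_add p u v = word_add p v u" if "length u = length v"
  using that by (auto simp: list_eq_iff_nth_eq add.commute)

lemma word_add_assoc: "word_add p (word_add p u v) w = word_add p u (word_add p v w)"
  by (auto simp: list_eq_iff_nth_eq mod_simps add.assoc)

lemma bij_betw_word_add:
  assumes "p > 0" "v \<in> words n p"
  shows "bij_betw (\<lambda>u. word_add p u v) (words n p) (words n p)"
  by (rule bij_betwI[where g = "\<lambda>u. word_sub p u v"])
     (use assms in \<open>auto simp: word_add_in_words word_sub_in_words word_add_sub_cancel\<close>)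

lemma word_dot_conv_sum:
  assumes "length b = n" "length w = n"
  shows "word_dot b w = (\<Sum>i<n. b ! i * w ! i)"
proof -
  have "sum_list (map2 (*) b w) = (\<Sum>i<length (map2 (*) b w). map2 (*) b w ! i)"
    unfolding sum_list_sum_nth by (simp add: atLeast0LessThan)
  also have "\<dots> = (\<Sum>i<n. b ! i * w ! i)"
    using assms by (intro sum.cong) auto
  finally show ?thesis unfolding word_dot_def .
qed

lemma word_dot_add_mod:
  assumes "length b = n" "length u = n" "length v = n"
  shows "word_dot b (word_add p u v) mod p = (word_dot b u + word_dot b v) mod p"
proof -
  have "word_dot b (word_add p u v) mod p = (\<Sum>i<n. b ! i * ((u ! i + v ! i) mod p)) mod p"
    using assms by (subst word_dot_conv_sum[of _ n]) auto
  also have "\<dots> = (\<Sum>i<n. b ! i * ((u ! i + v ! i) mod p) mod p) mod p"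
    by (rule mod_sum_eq[symmetric])
  also have "\<dots> = (\<Sum>i<n. b ! i * (u ! i + v ! i) mod p) mod p"
    by (simp add: mod_mult_right_eq)
  also have "\<dots> = (\<Sum>i<n. b ! i * (u ! i + v ! i)) mod p"
    by (rule mod_sum_eq)
  also have "\<dots> = (word_dot b u + word_dot b v) mod p"
    using assms by (simp add: word_dot_conv_sum[of _ n] sum.distrib distrib_left)
  finally show ?thesis .
qed

section \<open>Roots of unity and the Knill--Laflamme conditions\<close>

lemma cis_power_mod:
  assumes "p > 0"
  shows "cis (2 * pi / real p) ^ (k mod p) = cis (2 * pi / real p) ^ k"
proof -
  have *: "cis (2 * pi / real p) ^ p = 1"
    using assms by (simp add: DeMoivre)
  have "cis (2 * pi / real p) ^ k = cis (2 * pi / real p) ^ (p * (k div p) + k mod p)" by simp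
  then show ?thesis unfolding power_add power_mult * by simp
qed

lemma cis_power_inj:
  assumes "p > 0" "a < p" "b < p" "cis (2 * pi / real p) ^ a = cis (2 * pi / real p) ^ b"
  shows "a = b"
proof -
  have "cis (2 * pi * real a / real p) = cis (2 * pi * real b / real p)"
    using assms(4) by (simp add: DeMoivre mult_ac)
  then have "exp (\<i> * complex_of_real (2 * pi * real a / real p)) =
     exp (\<i> * complex_of_real (2 * pi * real b / real p))" by (simp add: cis_conv_exp)
  then show ?thesis using assms bij_betw_roots_unity[of p]
    unfolding bij_betw_def inj_on_def
    by (metis (mono_tags, lifting) \<open>cis (2 * pi * real a / real p) = _\<close> lessThan_iff mult.commute)
qed

text \<open>Knill--Laflamme for states that are supported on \<open>C1\<close> and invariant under translation by
  \<open>C2\<close>: two different flips move the supports apart, and for two different phase shifts a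
  translation by a word of \<open>C2\<close> that separates them multiplies the inner product by a
  nontrivial root of unity.\<close>

lemma knill_laflamme_coset_states:
  assumes p: "p > 0"
    and C1: "C1 \<subseteq> words n p" and C2: "C2 \<subseteq> words n p"
    and supp: "\<And>u w. u \<in> Q \<Longrightarrow> w \<notin> C1 \<Longrightarrow> u w = 0"
    and inv: "\<And>u w z. u \<in> Q \<Longrightarrow> w \<in> words n p \<Longrightarrow> z \<in> C2 \<Longrightarrow> u (word_add p w z) = u w"
    and flip: "\<And>a1 a2 w. \<lbrakk>a1 \<in> words n p; a2 \<in> words n p; wt a1 \<le> tx; wt a2 \<le> tx; w \<in> words n p;
         word_sub p w a1 \<in> C1; word_sub p w a2 \<in> C1\<rbrakk> \<Longrightarrow> a1 = a2"
    and phase: "\<And>b1 b2. \<lbrakk>b1 \<in> words n p; b2 \<in> words n p; wt b1 \<le> tz; wt b2 \<le> tz;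
         \<forall>z\<in>C2. word_dot b1 z mod p = word_dot b2 z mod p\<rbrakk> \<Longrightarrow> b1 = b2"
  shows "corrects n p Q tx tz"
  unfolding corrects_def
proof (intro allI impI, elim conjE)
  fix a1 b1 a2 b2
  assume a1: "a1 \<in> words n p" and b1: "b1 \<in> words n p" and a2: "a2 \<in> words n p"
    and b2: "b2 \<in> words n p" and w: "wt a1 \<le> tx" "wt a2 \<le> tx" "wt b1 \<le> tz" "wt b2 \<le> tz"
  define om where "om = cis (2 * pi / real p)"
  have om1: "cnj om * om = 1" by (simp add: om_def cis_cnj cis_mult)
  have omp: "om ^ k = om ^ l" if "k mod p = l mod p" for k l
    using cis_power_mod[OF p, of k] cis_power_mod[OF p, of l] that unfolding om_def by simp
  have err: "err_op n p a b v w = om ^ word_dot b (word_sub p w a) * v (word_sub p w a)"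
    if "w \<in> words n p" "a \<in> words n p" for a b v w
    using that word_sub_in_words[OF p that]
    by (simp add: err_op_def flipX_def phaseZ_def om_def word_dot_def word_sub_def)
  have inner: "inner_st n p (err_op n p a1 b1 u) (err_op n p a2 b2 v) =
      (\<Sum>w\<in>words n p. cnj (om ^ word_dot b1 (word_sub p w a1) * u (word_sub p w a1)) *
         (om ^ word_dot b2 (word_sub p w a2) * v (word_sub p w a2)))" for u v
    unfolding inner_st_def by (intro sum.cong refl) (simp add: err a1 a2)
  show "\<exists>c. \<forall>u\<in>Q. \<forall>v\<in>Q. inner_st n p (err_op n p a1 b1 u) (err_op n p a2 b2 v) = c * inner_st n p u v"
  proof (cases "a1 = a2")
    case False
    have "inner_st n p (err_op n p a1 b1 u) (err_op n p a2 b2 v) = 0" if "u \<in> Q" "v \<in> Q" for u v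
      unfolding inner
    proof (rule sum.neutral, rule ballI)
      fix x assume "x \<in> words n p"
      then have "word_sub p x a1 \<notin> C1 \<or> word_sub p x a2 \<notin> C1"
        using flip[OF a1 a2 w(1,2)] False by blast
      then show "cnj (om ^ word_dot b1 (word_sub p x a1) * u (word_sub p x a1)) *
         (om ^ word_dot b2 (word_sub p x a2) * v (word_sub p x a2)) = 0"
        using supp that by auto
    qed
    then show ?thesis by (intro exI[of _ 0]) simp
  next
    case True
    define F where "F u v w = cnj (om ^ word_dot b1 w * u w) * (om ^ word_dot b2 w * v w)"
      for u v w
    \<comment> \<open>Equal flips cancel: the substitution of \<open>w + a1\<close> for
      \<open>w\<close> permutes the basis words and leaves only the two phase shifts.\<close>
    have inner': "inner_st n p (err_op n p a1 b1 u) (err_op n p a2 b2 v) = (\<Sum>w\<in>words n p. F u v w)"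
      for u v
    proof -
      have "(\<Sum>w\<in>words n p. F u v w) = (\<Sum>w\<in>words n p. F u v (word_sub p w a1))"
        by (rule sum.reindex_bij_witness[of _ "\<lambda>w. word_sub p w a1" "\<lambda>w. word_add p w a1"])
           (use p a1 in \<open>auto simp: word_add_in_words word_sub_in_words word_add_sub_cancel\<close>)
      then show ?thesis unfolding inner F_def using True by simp
    qed
    show ?thesis
    proof (cases "b1 = b2")
      case True
      have "F u v w = cnj (u w) * v w" for u v w
      proof -
        have "F u v w = (cnj om * om) ^ word_dot b1 w * (cnj (u w) * v w)"
          unfolding F_def True by (simp add: power_mult_distrib mult_ac)
        then show ?thesis by (simp add: om1)
      qed
      then show ?thesis by (intro exI[of _ 1]) (simp only: inner', simp add: inner_st_def)
    next
      case False
      then obtain z where z: "z \<in> C2" and ne: "word_dot b1 z mod p \<noteq> word_dot b2 z mod p"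
        using phase[OF b1 b2 w(3,4)] by blast
      have zw: "z \<in> words n p" using z C2 by auto
      have len: "length b1 = n" "length b2 = n" "length z = n" using b1 b2 zw by (auto simp: words_iff)
      define e where "e = cnj (om ^ word_dot b1 z) * om ^ word_dot b2 z"
      have e1: "e \<noteq> 1"
      proof
        assume "e = 1"
        then have "om ^ word_dot b1 z * e = om ^ word_dot b1 z" by simp
        moreover have "om ^ word_dot b1 z * e = (cnj om * om) ^ word_dot b1 z * om ^ word_dot b2 z"
          unfolding e_def by (simp add: power_mult_distrib mult_ac)
        ultimately have "om ^ word_dot b1 z = om ^ word_dot b2 z" by (simp add: om1)
        then have "om ^ (word_dot b1 z mod p) = om ^ (word_dot b2 z mod p)"
          by (simp add: om_def cis_power_mod[OF p])
        then show False
          using ne cis_power_inj[OF p] p unfolding om_def by auto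
      qed
      have "(\<Sum>w\<in>words n p. F u v w) = 0" if uv: "u \<in> Q" "v \<in> Q" for u v
      proof -
        have "(\<Sum>w\<in>words n p. F u v w) = (\<Sum>w\<in>words n p. F u v (word_add p w z))"
          using sum.reindex_bij_betw[OF bij_betw_word_add[OF p zw], of "F u v"] by simp
        also have "\<dots> = (\<Sum>w\<in>words n p. e * F u v w)"
        proof (rule sum.cong[OF refl])
          fix w assume ww: "w \<in> words n p"
          then have lw: "length w = n" by (simp add: words_iff)
          have "om ^ word_dot b (word_add p w z) = om ^ word_dot b w * om ^ word_dot b z"
            if "length b = n" for b
            using omp[OF word_dot_add_mod[OF that lw len(3)]] by (simp add: power_add)
          then show "F u v (word_add p w z) = e * F u v w"
            using len inv[OF uv(1) ww z] inv[OF uv(2) ww z] unfolding F_def e_def by simp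
        qed
        also have "\<dots> = e * (\<Sum>w\<in>words n p. F u v w)" by (rule sum_distrib_left[symmetric])
        finally show ?thesis using e1 unfolding mult_cancel_right1 by blast
      qed
      then show ?thesis by (intro exI[of _ 0]) (simp add: inner')
    qed
  qed
qed

text \<open>The counting substitute for rank and nullity, applied to the coset map, to the trace and
  to the syndrome map.\<close>

lemma card_le_mult_fibres:
  assumes "finite A" "f ` A \<subseteq> B" "finite B" "\<And>b. b \<in> B \<Longrightarrow> card {a\<in>A. f a = b} \<le> c"
  shows "card A \<le> card B * c"
proof -
  have "A = (\<Union>b\<in>B. {a\<in>A. f a = b})" using assms(2) by auto
  then have "card A \<le> (\<Sum>b\<in>B. card {a\<in>A. f a = b})" using card_UN_le[OF assms(3)] by metis
  also have "\<dots> \<le> (\<Sum>b\<in>B. c)" by (rule sum_mono) (rule assms(4))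
  finally show ?thesis by simp
qed

text \<open>The code is spanned by the indicator functions of \<open>K\<close> distinct cosets of
  \<open>C2\<close> inside \<open>C1\<close>. Disjoint supports make them independent, and since a
  coset has at most \<open>card C2\<close> elements there are at least \<open>K\<close> cosets. The
  distances enter only through \<open>flip\<close> and \<open>phase\<close>, the uniqueness of small
  errors with a given effect.\<close>

theorem css_code_exists:
  assumes p: "p > 0"
    and C1: "C1 \<subseteq> words n p" and C2: "C2 \<subseteq> C1" and C2_ne: "C2 \<noteq> {}"
    and C1_add: "\<And>x z. x \<in> C1 \<Longrightarrow> z \<in> C2 \<Longrightarrow> word_add p x z \<in> C1"
    and C2_add: "\<And>x z. x \<in> C2 \<Longrightarrow> z \<in> C2 \<Longrightarrow> word_add p x z \<in> C2"
    and C2_sub: "\<And>x z. x \<in> C2 \<Longrightarrow> z \<in> C2 \<Longrightarrow> word_sub p x z \<in> C2"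
    and card: "K * card C2 \<le> card C1"
    and flip: "\<And>a1 a2 w. \<lbrakk>a1 \<in> words n p; a2 \<in> words n p; wt a1 \<le> tx; wt a2 \<le> tx; w \<in> words n p;
         word_sub p w a1 \<in> C1; word_sub p w a2 \<in> C1\<rbrakk> \<Longrightarrow> a1 = a2"
    and phase: "\<And>b1 b2. \<lbrakk>b1 \<in> words n p; b2 \<in> words n p; wt b1 \<le> tz; wt b2 \<le> tz;
         \<forall>z\<in>C2. word_dot b1 z mod p = word_dot b2 z mod p\<rbrakk> \<Longrightarrow> b1 = b2"
  shows "\<exists>Q. subspace_dim n p Q K \<and> corrects n p Q tx tz"
proof -
  have C2w: "C2 \<subseteq> words n p" using C1 C2 by auto
  have fin1: "finite C1" using C1 finite_words finite_subset by blast
  have fin2: "finite C2" using C2 fin1 finite_subset by blast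
  define zw where "zw = replicate n (0::nat)"
  have zww: "zw \<in> words n p" using p by (auto simp: zw_def words_iff)
  have add0: "word_add p x zw = x" if "x \<in> words n p" for x
    using that by (auto simp: list_eq_iff_nth_eq words_iff zw_def)
  have z0: "zw \<in> C2"
  proof -
    obtain c where c: "c \<in> C2" using C2_ne by auto
    have "word_sub p c c = zw"
      using c C2w by (subst word_sub_eq_iff) (auto simp: zww add0 word_add_commute subset_iff words_iff zw_def list_eq_iff_nth_eq p)
    then show ?thesis using C2_sub[OF c c] by simp
  qed
  define T where "T x = word_add p x ` C2" for x
  have T_sub: "T x \<subseteq> C1" if "x \<in> C1" for x using that C1_add by (auto simp: T_def)
  have T_self: "x \<in> T x" if "x \<in> C1" for x
    using add0[of x] that C1 z0 unfolding T_def by (metis imageI subsetD)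
  have T_inv: "word_add p w z \<in> T x \<longleftrightarrow> w \<in> T x" if x: "x \<in> C1" and w: "w \<in> words n p" and z: "z \<in> C2" for x w z
  proof
    assume "w \<in> T x"
    then show "word_add p w z \<in> T x" using C2_add[OF _ z] by (auto simp: T_def word_add_assoc)
  next
    assume "word_add p w z \<in> T x"
    then obtain y where y: "y \<in> C2" "word_add p w z = word_add p x y" by (auto simp: T_def)
    have "w = word_sub p (word_add p x y) z"
      using y w z C2w word_add_sub_cancel(2)[OF p w, of z] by auto
    also have "\<dots> = word_add p x (word_sub p y z)"
    proof (subst word_sub_eq_iff[where n=n])
      have "word_add p (word_sub p y z) z = y"
        using y z C2w by (intro word_add_sub_cancel[OF p, where n=n]) auto
      then show "word_add p x y = word_add p (word_add p x (word_sub p y z)) z"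
        by (simp add: word_add_assoc)
    qed (use x y z C1 C2w in \<open>auto intro!: word_add_in_words[OF p] word_sub_in_words[OF p]\<close>)
    finally show "w \<in> T x" using C2_sub[OF y(1) z] by (auto simp: T_def)
  qed
  have T_eq: "T x = T y" if "x \<in> C1" "y \<in> C1" "w \<in> T x" "w \<in> T y" for x y w
  proof -
    have sub: "T x' \<subseteq> T y'" if xy: "x' \<in> C1" "y' \<in> C1" and w: "w \<in> T x'" "w \<in> T y'" for x' y'
    proof
      fix v assume "v \<in> T x'"
      then obtain c where c: "c \<in> C2" "v = word_add p x' c" by (auto simp: T_def)
      obtain d where d: "d \<in> C2" "w = word_add p x' d" using w by (auto simp: T_def)
      have x'w: "x' \<in> words n p" using xy C1 by auto
      have "x' \<in> T y'" using T_inv[OF xy(2) x'w d(1)] w d by simp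
      then show "v \<in> T y'" using T_inv[OF xy(2) x'w c(1)] c by simp
    qed
    show ?thesis using sub[OF that] sub[OF that(2,1,4,3)] by blast
  qed
  define S where "S = T ` C1"
  have finS: "finite S" using fin1 by (simp add: S_def)
  have "card C1 \<le> card S * card C2"
  proof (rule card_le_mult_fibres[where f = T])
    fix b assume "b \<in> S"
    then obtain x where x: "x \<in> C1" "b = T x" by (auto simp: S_def)
    have "{a \<in> C1. T a = b} \<subseteq> T x" using x T_self by auto
    then have "card {a \<in> C1. T a = b} \<le> card (T x)"
      using fin2 by (intro card_mono) (auto simp: T_def)
    also have "\<dots> \<le> card C2" unfolding T_def by (rule card_image_le[OF fin2])
    finally show "card {a \<in> C1. T a = b} \<le> card C2" .
  qed (use fin1 finS in \<open>auto simp: S_def\<close>)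
  with card have "K * card C2 \<le> card S * card C2" by (rule le_trans)
  moreover have "card C2 > 0" using fin2 C2_ne by (simp add: card_gt_0_iff)
  ultimately have KS: "K \<le> card S" by simp
  obtain h where h: "bij_betw h {..<card S} S"
    using ex_bij_betw_nat_finite[OF finS] by (auto simp: atLeast0LessThan)
  have hS: "\<exists>x\<in>C1. h i = T x" if "i < K" for i
    using bij_betwE[OF h] that KS unfolding S_def by force
  have hdisj: "i = j" if "i < K" "j < K" "w \<in> h i" "w \<in> h j" for i j w
  proof -
    have "h i = h j" using hS[OF that(1)] hS[OF that(2)] that(3,4) T_eq by metis
    then show ?thesis using h that KS by (auto simp: bij_betw_def inj_on_def)
  qed
  have hne: "\<exists>w. w \<in> h i" if "i < K" for i using hS[OF that] T_self by metis
  define B :: "nat \<Rightarrow> nat list \<Rightarrow> complex" where "B i w = (if w \<in> h i then 1 else 0)" for i w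
  define Q where "Q = {(\<lambda>w. \<Sum>i<K. c i * B i w) | c :: nat \<Rightarrow> complex. True}"
  have "subspace_dim n p Q K"
    unfolding subspace_dim_def
  proof (intro exI[of _ B] conjI allI impI)
    fix i assume "i < K"
    then show "B i \<in> states n p"
      using hS[of i] T_sub C1 by (fastforce simp: states_def B_def)
  next
    fix c :: "nat \<Rightarrow> complex" and i
    assume c: "(\<lambda>w. \<Sum>i<K. c i * B i w) = (\<lambda>w. 0)" and i: "i < K"
    obtain w where w: "w \<in> h i" using hne[OF i] by auto
    have "(\<Sum>j<K. c j * B j w) = (\<Sum>j<K. if j = i then c j else 0)"
    proof (rule sum.cong[OF refl])
      fix j assume "j \<in> {..<K}"
      then have "w \<notin> h j" if "j \<noteq> i" using hdisj[OF i _ w, of j] that by auto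
      then show "c j * B j w = (if j = i then c j else 0)" using w by (auto simp: B_def)
    qed
    then show "c i = 0" using fun_cong[OF c, of w] i by simp
  qed (simp add: Q_def)
  moreover have "corrects n p Q tx tz"
  proof (rule knill_laflamme_coset_states[OF p C1 C2w _ _ flip phase])
    fix u w assume "u \<in> Q" "w \<notin> C1"
    then have "w \<notin> h i" if "i < K" for i using hS[OF that] T_sub by auto
    then show "u w = 0" using \<open>u \<in> Q\<close> by (auto simp: Q_def B_def intro!: sum.neutral)
  next
    fix u w z assume u: "u \<in> Q" and w: "w \<in> words n p" and z: "z \<in> C2"
    have "B i (word_add p w z) = B i w" if "i < K" for i
      using hS[OF that] T_inv[OF _ w z] by (auto simp: B_def)
    then show "u (word_add p w z) = u w" using u by (auto simp: Q_def)
  qed auto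
  ultimately show ?thesis by blast
qed

section \<open>Congruence modulo a prime ideal\<close>

locale ideal_cong =
  fixes P :: "'a::comm_ring_1 set"
  assumes zero_in [simp]: "0 \<in> P"
    and add_in: "x \<in> P \<Longrightarrow> y \<in> P \<Longrightarrow> x + y \<in> P"
    and mult_in: "x \<in> P \<Longrightarrow> y * x \<in> P"
begin

definition eqv :: "'a \<Rightarrow> 'a \<Rightarrow> bool"  (infix "\<approx>" 50) where
  "x \<approx> y \<longleftrightarrow> x - y \<in> P"

lemma mult_in': "x \<in> P \<Longrightarrow> x * y \<in> P"
  using mult_in[of x y] by (simp add: mult.commute)

lemma minus_in: "x \<in> P \<Longrightarrow> - x \<in> P"
  using mult_in[of x "-1"] by simp

lemma diff_in: "x \<in> P \<Longrightarrow> y \<in> P \<Longrightarrow> x - y \<in> P"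
  using add_in[of x "-y"] minus_in[of y] by simp

lemma eqv_refl [simp, intro]: "x \<approx> x"
  by (simp add: eqv_def)

lemma eqv_sym: "x \<approx> y \<Longrightarrow> y \<approx> x"
  using minus_in[of "x - y"] by (simp add: eqv_def)

lemma eqv_commute: "x \<approx> y \<longleftrightarrow> y \<approx> x"
  using eqv_sym by blast

lemma eqv_trans [trans]: "x \<approx> y \<Longrightarrow> y \<approx> z \<Longrightarrow> x \<approx> z"
  using add_in[of "x - y" "y - z"] by (simp add: eqv_def)

lemma eqv_zero_iff: "x \<approx> 0 \<longleftrightarrow> x \<in> P"
  by (simp add: eqv_def)

lemma eqv_diff_zero_iff: "x - y \<approx> 0 \<longleftrightarrow> x \<approx> y"
  by (simp add: eqv_def)

lemma eqv_add: "x \<approx> x' \<Longrightarrow> y \<approx> y' \<Longrightarrow> x + y \<approx> x' + y'"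
  using add_in[of "x - x'" "y - y'"] by (simp add: eqv_def algebra_simps)

lemma eqv_diff: "x \<approx> x' \<Longrightarrow> y \<approx> y' \<Longrightarrow> x - y \<approx> x' - y'"
  using diff_in[of "x - x'" "y - y'"] by (simp add: eqv_def algebra_simps)

lemma eqv_mult: "x \<approx> x' \<Longrightarrow> y \<approx> y' \<Longrightarrow> x * y \<approx> x' * y'"
  using add_in[OF mult_in'[of "x - x'" y] mult_in[of "y - y'" x']]
  by (simp add: eqv_def algebra_simps)

lemma eqv_power: "x \<approx> y \<Longrightarrow> x ^ k \<approx> y ^ k"
  by (induction k) (auto intro: eqv_mult)

lemma eqv_sum: "(\<And>i. i \<in> A \<Longrightarrow> f i \<approx> g i) \<Longrightarrow> sum f A \<approx> sum g A"
  by (induction A rule: infinite_finite_induct) (auto intro: eqv_add)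

lemma eqv_sum_zero: "(\<And>i. i \<in> A \<Longrightarrow> f i \<approx> 0) \<Longrightarrow> sum f A \<approx> 0"
  using eqv_sum[of A f "\<lambda>_. 0"] by simp

lemma eqv_mult_zero: "x \<approx> 0 \<Longrightarrow> x * y \<approx> 0" "x \<approx> 0 \<Longrightarrow> y * x \<approx> 0"
  by (auto simp: eqv_zero_iff mult_in mult_in')

text \<open>A system of representatives for the residue classes is the range of this map.\<close>

definition rep :: "'a \<Rightarrow> 'a" where
  "rep x = (SOME y. x \<approx> y)"

lemma rep_eqv: "rep x \<approx> x"
  unfolding rep_def by (rule eqv_sym, rule someI[of _ x]) simp

lemma rep_eq_iff: "rep x = rep y \<longleftrightarrow> x \<approx> y"
proof
  assume "rep x = rep y"
  then show "x \<approx> y" using eqv_trans[OF eqv_sym[OF rep_eqv[of x]]] rep_eqv[of y] by simp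
next
  assume "x \<approx> y"
  then have "(\<lambda>z. x \<approx> z) = (\<lambda>z. y \<approx> z)" using eqv_trans eqv_sym by blast
  then show "rep x = rep y" unfolding rep_def by simp
qed

lemma rep_rep [simp]: "rep (rep x) = rep x"
  by (simp add: rep_eq_iff rep_eqv)

lemma range_rep_eqv_iff: "x \<in> range rep \<Longrightarrow> y \<in> range rep \<Longrightarrow> x \<approx> y \<longleftrightarrow> x = y"
  by (auto simp flip: rep_eq_iff)

end

locale prime_ideal_cong = ideal_cong +
  assumes one_notin: "1 \<notin> P"
    and prime_in: "x * y \<in> P \<Longrightarrow> x \<in> P \<or> y \<in> P"
begin

lemma not_one_eqv_zero: "\<not> 1 \<approx> 0"
  by (simp add: eqv_zero_iff one_notin)

lemma mult_eqv_zeroD: "x * y \<approx> 0 \<Longrightarrow> x \<approx> 0 \<or> y \<approx> 0"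
  using prime_in by (simp add: eqv_zero_iff)

lemma mult_eqv_cancel: "x * y \<approx> x * z \<Longrightarrow> \<not> x \<approx> 0 \<Longrightarrow> y \<approx> z"
  using mult_eqv_zeroD[of x "y - z"] by (auto simp: eqv_diff_zero_iff algebra_simps eqv_def)

lemma power_eqv_zeroD: "x ^ k \<approx> 0 \<Longrightarrow> x \<approx> 0"
  by (induction k) (auto dest: mult_eqv_zeroD simp: not_one_eqv_zero)

lemma prod_eqv_zeroD: "finite A \<Longrightarrow> prod f A \<approx> 0 \<Longrightarrow> \<exists>i\<in>A. f i \<approx> 0"
  by (induction A rule: finite_induct) (auto dest: mult_eqv_zeroD simp: not_one_eqv_zero)

text \<open>The root bound for polynomials over a domain, stated for lifts to the ring: the leading
  coefficient of \<open>f\<close> may itself be congruent to zero. Synthetic division by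
  \<open>X - a\<close> lowers the degree, and the other roots survive because \<open>x - a\<close>
  is not in the prime ideal.\<close>

lemma coeffs_eqv_zero:
  assumes "finite S" "\<And>x y. x \<in> S \<Longrightarrow> y \<in> S \<Longrightarrow> x \<approx> y \<Longrightarrow> x = y"
    "card S > degree f" "\<And>x. x \<in> S \<Longrightarrow> poly f x \<approx> 0"
  shows "coeff f i \<approx> 0"
  using assms
proof (induction "card S" arbitrary: S f i)
  case 0
  then show ?case by simp
next
  case (Suc k)
  then obtain a where a: "a \<in> S" by force
  define g where "g = synthetic_div f a"
  have f: "f + smult a g = pCons (poly f a) g"
    unfolding g_def by (rule synthetic_div_correct)
  have coeff_g: "coeff g j \<approx> 0" for j
  proof (cases "degree f = 0")
    case True
    then have "g = 0" unfolding g_def by (simp add: synthetic_div_eq_0_iff)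
    then show ?thesis by simp
  next
    case False
    show ?thesis
    proof (rule Suc.hyps(1))
      show "k = card (S - {a})" using Suc.hyps(2) a Suc.prems(1) by simp
      show "degree g < card (S - {a})"
        using Suc.prems(1,3) a False by (simp add: g_def degree_synthetic_div)
      fix x assume x: "x \<in> S - {a}"
      have "poly f x + a * poly g x = poly f a + x * poly g x"
        using arg_cong[OF f, of "\<lambda>h. poly h x"] by simp
      then have "(x - a) * poly g x = poly f x - poly f a" by (simp add: algebra_simps)
      also have "\<dots> \<approx> 0 - 0" using x a Suc.prems(4) by (intro eqv_diff) auto
      finally have "x - a \<approx> 0 \<or> poly g x \<approx> 0" by (intro mult_eqv_zeroD) simp
      then show "poly g x \<approx> 0" using x a Suc.prems(2) by (auto simp: eqv_diff_zero_iff)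
    qed (use Suc.prems in auto)
  qed
  have "coeff f i + a * coeff g i = coeff (pCons (poly f a) g) i"
    using arg_cong[OF f, of "\<lambda>h. coeff h i"] by simp
  then have "coeff f i = coeff (pCons (poly f a) g) i - a * coeff g i" by (simp add: algebra_simps)
  also have "\<dots> \<approx> 0 - a * 0"
    using Suc.prems(4)[OF a] coeff_g by (intro eqv_diff eqv_mult) (auto simp: coeff_pCons split: nat.splits)
  finally show ?case by simp
qed

text \<open>Finiteness of \<open>S\<close> is a conclusion, since an infinite \<open>S\<close> would
  contain \<open>d + 1\<close> incongruent roots; this is how the residue ring is later seen to be
  finite. The index \<open>i\<close> witnesses that \<open>f\<close> is nonzero modulo the
  ideal.\<close>

lemma card_roots_le:
  assumes "\<And>x y. x \<in> S \<Longrightarrow> y \<in> S \<Longrightarrow> x \<approx> y \<Longrightarrow> x = y"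
    "\<And>x. x \<in> S \<Longrightarrow> poly f x \<approx> 0" "degree f \<le> d" "\<not> coeff f i \<approx> 0"
  shows "finite S" "card S \<le> d"
proof -
  have *: "card T \<le> d" if T: "T \<subseteq> S" "finite T" for T
  proof (rule ccontr)
    assume "\<not> card T \<le> d"
    then have "coeff f i \<approx> 0"
      using assms T by (intro coeffs_eqv_zero[of T]) auto
    then show False using assms(4) by simp
  qed
  show fin: "finite S"
  proof (rule ccontr)
    assume "infinite S"
    then obtain T where "T \<subseteq> S" "finite T" "card T = Suc d"
      using infinite_arbitrarily_large by blast
    then show False using *[of T] by simp
  qed
  show "card S \<le> d" using * fin by blast
qed

text \<open>The Vandermonde argument: pair the equations with the coefficients of the
  polynomial that vanishes at all nodes but one.\<close>

lemma vandermonde_eqv_zero: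
  assumes fin: "finite J" and inj: "\<And>i j. i \<in> J \<Longrightarrow> j \<in> J \<Longrightarrow> x i \<approx> x j \<Longrightarrow> i = j"
    and eqs: "\<And>r. r < card J \<Longrightarrow> (\<Sum>j\<in>J. c j * x j ^ r) \<approx> 0" and i: "i \<in> J"
  shows "c i \<approx> 0"
proof -
  \<comment> \<open>The unnormalised Lagrange polynomial of node \<open>i\<close>.\<close>
  define g where "g = (\<Prod>j\<in>J - {i}. [:- x j, 1:])"
  have deg: "degree g < card J"
  proof -
    have "degree g \<le> (\<Sum>j\<in>J - {i}. degree [:- x j, 1:])"
      unfolding g_def by (intro degree_prod_sum_le[THEN order.trans]) (use fin in auto)
    also have "\<dots> = card J - 1" using fin i by simp
    also have "\<dots> < card J" using fin i by (metis card_gt_0_iff diff_less empty_iff less_one)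
    finally show ?thesis .
  qed
  have g0: "poly g (x j) = (if j = i then poly g (x i) else 0)" if "j \<in> J" for j
    using fin that by (auto simp: g_def poly_prod intro!: prod_zero)
  have "c i * poly g (x i) = (\<Sum>j\<in>J. if j = i then c j * poly g (x j) else 0)"
    using fin i by simp
  also have "\<dots> = (\<Sum>j\<in>J. c j * poly g (x j))"
    by (rule sum.cong) (auto simp: g0)
  also have "\<dots> = (\<Sum>j\<in>J. \<Sum>r\<le>degree g. coeff g r * (c j * x j ^ r))"
    by (simp add: poly_altdef sum_distrib_left mult_ac)
  also have "\<dots> = (\<Sum>r\<le>degree g. coeff g r * (\<Sum>j\<in>J. c j * x j ^ r))"
    by (subst sum.swap) (simp add: sum_distrib_left)
  also have "\<dots> \<approx> 0"
    by (intro eqv_sum_zero eqv_mult_zero(2) eqs) (use deg in auto)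
  finally have "c i \<approx> 0 \<or> poly g (x i) \<approx> 0" by (rule mult_eqv_zeroD)
  moreover have "\<not> poly g (x i) \<approx> 0"
  proof
    assume "poly g (x i) \<approx> 0"
    then have "(\<Prod>j\<in>J - {i}. x i - x j) \<approx> 0"
      by (simp add: g_def poly_prod)
    from prod_eqv_zeroD[OF _ this] fin obtain j where "j \<in> J - {i}" "x i - x j \<approx> 0" by auto
    then show False using inj i by (auto simp: eqv_diff_zero_iff)
  qed
  ultimately show ?thesis by simp
qed

end

text \<open>Additivity of the Frobenius needs only that \<open>p\<close> lies in the ideal.
  Primality is left out because these facts are applied to an ideal before it is known to be
  prime.\<close>

locale char_ideal_cong = ideal_cong +
  fixes p :: nat
  assumes prime_p: "prime p" and p_in: "of_nat p \<in> P"
begin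

lemma p_pos: "p > 0"
  using prime_p by (simp add: prime_gt_0_nat)

lemma of_nat_dvd_eqv_zero: "p dvd k \<Longrightarrow> of_nat k \<approx> 0"
  using p_in by (auto simp: eqv_zero_iff elim!: dvdE intro: mult_in')

lemma of_int_dvd_eqv_zero: "int p dvd k \<Longrightarrow> of_int k \<approx> 0"
  using p_in by (auto simp: eqv_zero_iff elim!: dvdE intro: mult_in')

lemma of_int_eqvI: "int p dvd a - b \<Longrightarrow> of_int a \<approx> of_int b"
  using of_int_dvd_eqv_zero[of "a - b"] by (simp add: eqv_diff_zero_iff)

lemma frobenius_add: "(x + y) ^ p \<approx> x ^ p + y ^ p"
proof -
  have "(x + y) ^ p = (\<Sum>k\<le>p. of_nat (p choose k) * x ^ k * y ^ (p - k))"
    by (rule binomial_ring)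
  also have "\<dots> \<approx> (\<Sum>k\<le>p. (if k = 0 then y ^ p else 0) + (if k = p then x ^ p else 0))"
  proof (rule eqv_sum)
    fix k assume k: "k \<in> {..p}"
    show "of_nat (p choose k) * x ^ k * y ^ (p - k) \<approx>
        (if k = 0 then y ^ p else 0) + (if k = p then x ^ p else 0)"
    proof (cases "k = 0 \<or> k = p")
      case True
      then show ?thesis using p_pos by auto
    next
      case False
      then have "p dvd p choose k" using k by (intro dvd_choose_prime prime_p) auto
      then have "of_nat (p choose k) * x ^ k * y ^ (p - k) \<approx> 0"
        by (intro eqv_mult_zero of_nat_dvd_eqv_zero)
      then show ?thesis using False by simp
    qed
  qed
  also have "\<dots> = x ^ p + y ^ p" by (simp add: sum.distrib)
  finally show ?thesis .
qed

lemma frobenius_pow_add: "(x + y) ^ (p ^ k) \<approx> x ^ (p ^ k) + y ^ (p ^ k)"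
proof (induction k)
  case (Suc k)
  have "(x + y) ^ (p ^ Suc k) = ((x + y) ^ (p ^ k)) ^ p" by (simp add: power_mult[symmetric] mult.commute)
  also have "\<dots> \<approx> (x ^ (p ^ k) + y ^ (p ^ k)) ^ p" by (rule eqv_power[OF Suc])
  also have "\<dots> \<approx> (x ^ (p ^ k)) ^ p + (y ^ (p ^ k)) ^ p" by (rule frobenius_add)
  also have "\<dots> = x ^ (p ^ Suc k) + y ^ (p ^ Suc k)" by (simp add: power_mult[symmetric] mult.commute)
  finally show ?case .
qed simp

lemma frobenius_pow_diff: "(x - y) ^ (p ^ k) \<approx> x ^ (p ^ k) - y ^ (p ^ k)"
  using eqv_diff[OF frobenius_pow_add[of "x - y" y k] eqv_refl[of "y ^ (p ^ k)"]]
  by (simp add: eqv_commute)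

lemma frobenius_pow_sum: "(\<Sum>i\<in>A. f i) ^ (p ^ k) \<approx> (\<Sum>i\<in>A. f i ^ (p ^ k))"
proof (induction A rule: infinite_finite_induct)
  case (insert x F)
  then show ?case
    using eqv_trans[OF frobenius_pow_add eqv_add[OF eqv_refl insert.IH]] by simp
qed (use p_pos in \<open>auto simp: power_0_left\<close>)

lemma frobenius_of_int: "of_int c ^ (p ^ k) \<approx> of_int c"
proof (induction c rule: int_induct[where k = 0])
  case base
  then show ?case using p_pos by (simp add: power_0_left)
next
  case (step1 i)
  have "of_int (i + 1) ^ p ^ k \<approx> of_int i ^ p ^ k + 1 ^ p ^ k"
    using frobenius_pow_add[of "of_int i" 1 k] by simp
  also have "\<dots> \<approx> of_int i + 1 ^ p ^ k" by (intro eqv_add step1 eqv_refl)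
  finally show ?case by simp
next
  case (step2 i)
  have "of_int (i - 1) ^ p ^ k \<approx> of_int i ^ p ^ k - 1 ^ p ^ k"
    using frobenius_pow_diff[of "of_int i" 1 k] by simp
  also have "\<dots> \<approx> of_int i - 1 ^ p ^ k" by (intro eqv_diff step2 eqv_refl)
  finally show ?case by simp
qed

end

locale char_prime_ideal = prime_ideal_cong + char_ideal_cong
begin

lemma of_int_eqv_zero_iff: "of_int k \<approx> 0 \<longleftrightarrow> int p dvd k"
proof
  assume k: "of_int k \<approx> 0"
  show "int p dvd k"
  proof (rule ccontr)
    assume "\<not> int p dvd k"
    then have "coprime k (int p)" using prime_p by (metis coprime_commute prime_imp_coprime prime_nat_int_transfer)
    then obtain u v where uv: "u * k + v * int p = 1" using bezout_int[of k "int p"] by auto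
    have "(1::'a) = of_int (u * k + v * int p)" by (simp add: uv)
    also have "\<dots> = of_int u * of_int k + of_int v * of_nat p" by simp
    also have "\<dots> \<approx> 0 + 0"
      by (intro eqv_add eqv_mult_zero(2) k) (simp add: eqv_zero_iff p_in)
    finally show False using not_one_eqv_zero by simp
  qed
qed (rule of_int_dvd_eqv_zero)

lemma of_int_eqv_iff: "of_int a \<approx> of_int b \<longleftrightarrow> int p dvd a - b"
  using of_int_eqv_zero_iff[of "a - b"] by (simp add: eqv_diff_zero_iff)

lemma of_nat_eqv_imp_eq: "of_nat a \<approx> of_nat b \<Longrightarrow> a < p \<Longrightarrow> b < p \<Longrightarrow> a = b"
  using of_int_eqv_iff[of "int a" "int b"] by (simp add: mod_eq_dvd_iff[symmetric])

lemma frobenius_pow_eqv_iff: "x ^ (p ^ k) \<approx> y ^ (p ^ k) \<longleftrightarrow> x \<approx> y"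
proof
  assume "x ^ (p ^ k) \<approx> y ^ (p ^ k)"
  then have "(x - y) ^ (p ^ k) \<approx> 0"
    using eqv_trans[OF frobenius_pow_diff] eqv_diff_zero_iff by blast
  then show "x \<approx> y" using power_eqv_zeroD eqv_diff_zero_iff by blast
qed (rule eqv_power)

end

lemma sum_lessThan_mult:
  fixes f :: "nat \<Rightarrow> 'a::comm_monoid_add"
  shows "(\<Sum>k<r * s. f k) = (\<Sum>j<r. \<Sum>i<s. f (j * s + i))"
proof -
  have *: "(\<Sum>k<a + b. f k) = (\<Sum>k<a. f k) + (\<Sum>i<b. f (a + i))" for a b
    by (induction b) (simp_all add: add.assoc)
  show ?thesis
  proof (induction r)
    case (Suc r)
    then show ?case using *[of "r * s" s] by (simp add: add.commute)
  qed simp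
qed

context prime_ideal_cong
begin

lemma card_power_fixed_le:
  assumes "a > 1" "\<And>x y. x \<in> S \<Longrightarrow> y \<in> S \<Longrightarrow> x \<approx> y \<Longrightarrow> x = y" "\<And>x. x \<in> S \<Longrightarrow> x ^ a \<approx> x"
  shows "finite S" "card S \<le> a"
proof -
  define f :: "'a poly" where "f = monom 1 a - monom 1 1"
  have deg: "degree f \<le> a" unfolding f_def
    using assms(1) by (intro degree_diff_le) (auto intro: degree_monom_le order.trans[OF degree_monom_le])
  have "coeff f a = 1" unfolding f_def using assms(1) by simp
  then have co: "\<not> coeff f a \<approx> 0" using not_one_eqv_zero by simp
  have "poly f x \<approx> 0" if "x \<in> S" for x
    using assms(3)[OF that] by (simp add: f_def poly_monom eqv_diff_zero_iff)
  from card_roots_le[OF assms(2) this deg co] show "finite S" "card S \<le> a" by auto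
qed

end

section \<open>Traces as polynomial expressions\<close>

context ideal_cong
begin

text \<open>The trace from the field of order \<open>b ^ r\<close> to the field of order
  \<open>b\<close>. As a polynomial it is defined on the whole ring, and it has the meaning of a
  trace only up to congruence.\<close>

definition tr :: "nat \<Rightarrow> nat \<Rightarrow> 'a \<Rightarrow> 'a" where
  "tr b r x = (\<Sum>j<r. x ^ (b ^ j))"

lemma tr_cong: "x \<approx> y \<Longrightarrow> tr b r x \<approx> tr b r y"
  unfolding tr_def by (intro eqv_sum eqv_power)

lemma power_iter_fixed: "x ^ b \<approx> x \<Longrightarrow> x ^ (b ^ j) \<approx> x"
proof (induction j)
  case (Suc j)
  have "x ^ (b ^ Suc j) = (x ^ b ^ j) ^ b" by (simp add: power_mult[symmetric] mult.commute)
  also have "\<dots> \<approx> x ^ b" by (intro eqv_power Suc)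
  also have "\<dots> \<approx> x" by (rule Suc)
  finally show ?case .
qed simp

lemma tr_scale:
  assumes "c ^ b \<approx> c"
  shows "tr b r (c * x) \<approx> c * tr b r x"
  unfolding tr_def sum_distrib_left power_mult_distrib
  by (intro eqv_sum eqv_mult power_iter_fixed assms eqv_refl)

end

context prime_ideal_cong
begin

text \<open>A fibre consists of roots of a monic polynomial of degree \<open>b ^ (r - 1)\<close>.
  This bound yields both the size of the subfield of order \<open>q\<close> and the nondegeneracy of
  the trace form.\<close>

lemma card_tr_fibre_le:
  assumes "b > 1" "r > 0" "\<And>x y. x \<in> S \<Longrightarrow> y \<in> S \<Longrightarrow> x \<approx> y \<Longrightarrow> x = y" "\<And>x. x \<in> S \<Longrightarrow> tr b r x \<approx> c"
  shows "card S \<le> b ^ (r - 1)"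
proof -
  define f :: "'a poly" where "f = (\<Sum>j<r. monom 1 (b ^ j)) - [:c:]"
  have deg: "degree f \<le> b ^ (r - 1)" unfolding f_def
  proof (intro degree_diff_le degree_sum_le)
    fix j assume "j \<in> {..<r}"
    then have "b ^ j \<le> b ^ (r - 1)" using assms(1) by (intro power_increasing) auto
    then show "degree (monom 1 (b ^ j) :: 'a poly) \<le> b ^ (r - 1)"
      using degree_monom_le order.trans by blast
  qed auto
  have "coeff f (b ^ (r - 1)) = (\<Sum>j<r. if j = r - 1 then 1 else 0)"
  proof -
    have "coeff [:c:] (b ^ (r - 1)) = 0"
      using assms(1) by (simp add: coeff_pCons split: nat.splits)
    then show ?thesis using assms(1) by (simp add: f_def coeff_sum power_inject_exp)
  qed
  also have "\<dots> = 1" using assms(2) by simp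
  finally have co: "\<not> coeff f (b ^ (r - 1)) \<approx> 0" using not_one_eqv_zero by simp
  have "poly f x \<approx> 0" if "x \<in> S" for x
    using assms(4)[OF that] by (simp add: f_def poly_monom poly_sum eqv_diff_zero_iff tr_def)
  from card_roots_le[OF assms(3) this deg co] show ?thesis by auto
qed

end

context char_ideal_cong
begin

lemma tr_add:
  assumes "b = p ^ s"
  shows "tr b r (x + y) \<approx> tr b r x + tr b r y"
  unfolding tr_def sum.distrib[symmetric]
  by (intro eqv_sum) (simp add: assms frobenius_pow_add flip: power_mult)

lemma tr_sum:
  assumes "b = p ^ s"
  shows "tr b r (\<Sum>i\<in>A. f i) \<approx> (\<Sum>i\<in>A. tr b r (f i))"
proof -
  have "tr b r (\<Sum>i\<in>A. f i) \<approx> (\<Sum>j<r. \<Sum>i\<in>A. f i ^ (b ^ j))"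
    unfolding tr_def by (intro eqv_sum) (simp add: assms frobenius_pow_sum flip: power_mult)
  then show ?thesis by (subst (asm) sum.swap) (simp add: tr_def)
qed

text \<open>Raising to the power \<open>b\<close> shifts the summands by one place, and the last one
  wraps around to \<open>x\<close>.\<close>

lemma tr_power_fixed:
  assumes "b = p ^ s" "x ^ (b ^ r) \<approx> x"
  shows "tr b r x ^ b \<approx> tr b r x"
proof -
  have "tr b r x ^ b \<approx> (\<Sum>j<r. (x ^ (b ^ j)) ^ b)"
    unfolding tr_def assms(1) by (rule frobenius_pow_sum)
  also have "\<dots> = (\<Sum>j<r. x ^ (b ^ Suc j))" by (simp add: power_mult[symmetric] mult.commute)
  also have "\<dots> = (\<Sum>j<Suc r. x ^ (b ^ j)) - x"
    by (subst sum.lessThan_Suc_shift) simp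
  also have "\<dots> = tr b r x + (x ^ (b ^ r) - x)" by (simp add: tr_def)
  also have "\<dots> \<approx> tr b r x + 0" by (intro eqv_add eqv_refl) (use assms(2) in \<open>simp add: eqv_diff_zero_iff\<close>)
  finally show ?thesis by simp
qed

text \<open>Transitivity of the trace: each exponent index below \<open>s * r\<close> is uniquely
  \<open>j * s + i\<close> with \<open>i < s\<close> and \<open>j < r\<close>.\<close>

lemma tr_tower: "tr p (s * r) x \<approx> tr p s (tr (p ^ s) r x)"
proof -
  have "tr p s (tr (p ^ s) r x) \<approx> (\<Sum>i<s. \<Sum>j<r. (x ^ ((p ^ s) ^ j)) ^ (p ^ i))"
    unfolding tr_def by (intro eqv_sum) (simp add: frobenius_pow_sum)
  also have "\<dots> = (\<Sum>i<s. \<Sum>j<r. x ^ (p ^ (j * s + i)))"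
    by (simp add: power_mult[symmetric] power_add mult.commute)
  also have "\<dots> = (\<Sum>j<r. \<Sum>i<s. x ^ (p ^ (j * s + i)))" by (rule sum.swap)
  also have "\<dots> = (\<Sum>k<r * s. x ^ (p ^ k))" by (rule sum_lessThan_mult[symmetric])
  finally show ?thesis by (simp add: tr_def eqv_commute mult.commute)
qed

end

section \<open>The prime field, conjugates and independence of powers\<close>

context char_prime_ideal
begin

text \<open>The numbers below \<open>p\<close> already supply \<open>p\<close> incongruent roots of
  \<open>X ^ p - X\<close>, which leaves no room for another.\<close>

lemma prime_field_of_nat:
  assumes "y ^ p \<approx> y"
  shows "\<exists>c<p. y \<approx> of_nat c"
proof (rule ccontr)
  assume *: "\<not> ?thesis"
  have p1: "p > 1" using prime_p by (rule prime_gt_1_nat)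
  define S where "S = insert y (of_nat ` {..<p})"
  have inj: "inj_on (of_nat :: nat \<Rightarrow> 'a) {..<p}"
    using of_nat_eqv_imp_eq by (auto intro!: inj_onI)
  have "y \<notin> of_nat ` {..<p}" using * by auto
  then have "card S = Suc p" by (simp add: S_def card_image[OF inj])
  moreover have "card S \<le> p"
  proof (rule card_power_fixed_le[OF p1])
    fix x z assume "x \<in> S" "z \<in> S" "x \<approx> z"
    then show "x = z" using * of_nat_eqv_imp_eq by (auto simp: S_def eqv_commute[of "of_nat _" y])
  next
    fix x assume "x \<in> S"
    then show "x ^ p \<approx> x"
      using assms frobenius_of_int[of "int _" 1] by (auto simp: S_def)
  qed
  ultimately show False by simp
qed

text \<open>The Frobenius is injective modulo a prime ideal, so a coincidence of two conjugates can
  be pulled back to one that involves \<open>x\<close> itself.\<close>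

lemma conjugates_distinct:
  assumes conj: "\<And>d. 0 < d \<Longrightarrow> d < k \<Longrightarrow> \<not> x ^ (p ^ d) \<approx> x"
    and eq: "x ^ (p ^ i) \<approx> x ^ (p ^ j)" and ij: "i < k" "j < k"
  shows "i = j"
proof -
  have *: "\<not> x ^ (p ^ a) \<approx> x ^ (p ^ b)" if "a < b" "b < k" for a b
  proof
    assume "x ^ (p ^ a) \<approx> x ^ (p ^ b)"
    also have "x ^ (p ^ b) = (x ^ (p ^ (b - a))) ^ (p ^ a)"
      using that by (simp add: power_mult[symmetric] power_add[symmetric])
    finally have "x \<approx> x ^ (p ^ (b - a))" by (simp add: frobenius_pow_eqv_iff)
    then have "x ^ (p ^ (b - a)) \<approx> x" by (rule eqv_sym)
    then show False using conj[of "b - a"] that by auto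
  qed
  show ?thesis using *[of i j] *[of j i] eq eqv_sym[OF eq] ij by (cases i j rule: linorder_cases) auto
qed

text \<open>If the first \<open>k\<close> conjugates of \<open>x\<close> are distinct, they are roots of every polynomial over the
  prime field that annihilates \<open>x\<close>.\<close>

lemma powers_independent:
  assumes conj: "\<And>d. 0 < d \<Longrightarrow> d < k \<Longrightarrow> \<not> x ^ (p ^ d) \<approx> x"
    and zero: "(\<Sum>i<k. of_int (c i) * x ^ i) \<approx> 0" and i: "i < k"
  shows "int p dvd c i"
proof -
  define F :: "'a poly" where "F = (\<Sum>i<k. monom (of_int (c i)) i)"
  define S where "S = (\<lambda>j. x ^ (p ^ j)) ` {..<k}"
  note dist = conjugates_distinct[OF conj]
  have "card S = k" unfolding S_def using dist by (subst card_image) (auto intro!: inj_onI)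
  moreover have "degree F \<le> k - 1" unfolding F_def
    by (intro degree_sum_le) (auto intro: order.trans[OF degree_monom_le])
  ultimately have "degree F < card S" using i by simp
  then have "coeff F i \<approx> 0"
  proof (rule coeffs_eqv_zero[rotated 2])
    fix y assume "y \<in> S"
    then obtain j where y: "y = x ^ (p ^ j)" by (auto simp: S_def)
    have "poly F y = (\<Sum>i<k. of_int (c i) * (x ^ i) ^ (p ^ j))"
      by (simp add: F_def poly_sum poly_monom y power_mult[symmetric] mult.commute)
    also have "\<dots> \<approx> (\<Sum>i<k. (of_int (c i) * x ^ i) ^ (p ^ j))"
      unfolding power_mult_distrib by (intro eqv_sum eqv_mult eqv_refl eqv_sym[OF frobenius_of_int])
    also have "\<dots> \<approx> (\<Sum>i<k. of_int (c i) * x ^ i) ^ (p ^ j)"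
      by (rule eqv_sym[OF frobenius_pow_sum])
    also have "\<dots> \<approx> 0 ^ (p ^ j)" by (intro eqv_power zero)
    finally show "poly F y \<approx> 0" using p_pos by (simp add: power_0_left)
  qed (use dist in \<open>auto simp: S_def\<close>)
  then show ?thesis using i by (simp add: F_def coeff_sum of_int_eqv_zero_iff)
qed

text \<open>Produces \<open>p ^ k\<close> residue classes: with \<open>k = M\<close> the lower bound
  on the size of the whole field, with \<open>k = t\<close> a basis of the subfield of order
  \<open>q\<close>.\<close>

lemma inj_on_power_combinations:
  assumes conj: "\<And>d. 0 < d \<Longrightarrow> d < k \<Longrightarrow> \<not> x ^ (p ^ d) \<approx> x"
  shows "inj_on (\<lambda>w. rep (\<Sum>i<k. of_nat (w ! i) * x ^ i)) (words k p)"
proof (rule inj_onI)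
  fix v w assume v: "v \<in> words k p" and w: "w \<in> words k p"
    and "rep (\<Sum>i<k. of_nat (v ! i) * x ^ i) = rep (\<Sum>i<k. of_nat (w ! i) * x ^ i)"
  then have "(\<Sum>i<k. of_nat (v ! i) * x ^ i) - (\<Sum>i<k. of_nat (w ! i) * x ^ i) \<approx> 0"
    by (simp add: rep_eq_iff eqv_diff_zero_iff)
  then have "(\<Sum>i<k. of_int (int (v ! i) - int (w ! i)) * x ^ i) \<approx> 0"
    by (simp add: sum_subtractf[symmetric] algebra_simps)
  then have dvd: "int p dvd int (v ! i) - int (w ! i)" if "i < k" for i
    using powers_independent[of k x "\<lambda>i. int (v ! i) - int (w ! i)"] conj that by blast
  have "v ! i = w ! i" if "i < k" for i
    using dvd[OF that] that v w by (auto simp: words_iff mod_eq_dvd_iff[symmetric])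
  then show "v = w" using v w by (auto simp: words_iff list_eq_iff_nth_eq)
qed

end

text \<open>The interface between the construction of the field and its use in codes. Invertibility
  of nonzero classes follows from \<open>fermat\<close>, which makes an inverse a power.\<close>

locale galois_cong = char_prime_ideal +
  fixes M :: nat
  assumes M_pos: "M > 0" and fermat: "x ^ (p ^ M) \<approx> x" and card_range_rep: "card (range rep) = p ^ M"

text \<open>Serves twice: the product of the \<open>X ^ p ^ d - X\<close> has degree below
  \<open>p ^ M\<close>, and the fixed sets of the lower Frobenius powers cannot cover the field of
  order \<open>q\<close>.\<close>

lemma sum_powers_less:
  fixes p :: nat assumes "p \<ge> 2" shows "(\<Sum>d\<in>{1..<k}. p ^ d) < p ^ k"
proof (cases "k = 0")
  case False
  have "(\<Sum>d<k. p ^ d) < p ^ k"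
  proof (induction k)
    case (Suc k)
    have "(\<Sum>d<Suc k. p ^ d) < 2 * p ^ k" using Suc by simp
    also have "\<dots> \<le> p ^ Suc k" using assms by simp
    finally show ?case .
  qed simp
  moreover have "(\<Sum>d\<in>{1..<k}. p ^ d) \<le> (\<Sum>d<k. p ^ d)" by (rule sum_mono2) auto
  ultimately show ?thesis by simp
qed simp

section \<open>Existence of finite fields as residue rings of integer polynomials\<close>

text \<open>Modulo the ideal the \<open>p ^ k\<close>-th power map is additive and multiplicative;
  it fixes the integers, and \<open>X\<close> by hypothesis, hence everything built from
  them.\<close>

lemma fermat_int_poly:
  fixes P :: "int poly set"
  assumes "char_ideal_cong P p" and X: "monom 1 (p ^ k) - monom 1 1 \<in> P"
  shows "y ^ (p ^ k) - y \<in> P"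
proof -
  interpret char_ideal_cong P p by fact
  have "y ^ (p ^ k) \<approx> y"
  proof (induction y)
    case 0
    then show ?case using p_pos by (simp add: power_0_left)
  next
    case (pCons a y)
    have *: "pCons a y = of_int a + monom 1 1 * y"
      by (simp add: of_int_poly monom_altdef)
    have "pCons a y ^ (p ^ k) \<approx> of_int a ^ (p ^ k) + (monom 1 1 * y) ^ (p ^ k)"
      unfolding * by (rule frobenius_pow_add)
    also have "\<dots> \<approx> of_int a + monom 1 1 * y"
      unfolding power_mult_distrib
    proof (intro eqv_add eqv_mult frobenius_of_int pCons.IH)
      show "monom 1 1 ^ p ^ k \<approx> (monom 1 1 :: int poly)"
        using X by (simp add: eqv_def monom_power)
    qed
    finally show ?case unfolding * .
  qed
  then show ?thesis by (simp add: eqv_def)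
qed

lemma ideal_cong_generated:
  fixes b :: "'a::comm_ring_1"
  assumes "ideal_cong P"
  shows "ideal_cong {x + b * y | x y. x \<in> P}"
proof -
  interpret ideal_cong P by fact
  show ?thesis
  proof
    show "0 \<in> {x + b * y | x y. x \<in> P}" by (auto intro!: exI[of _ 0])
  next
    fix u v assume "u \<in> {x + b * y | x y. x \<in> P}" "v \<in> {x + b * y | x y. x \<in> P}"
    then obtain x y x' y' where "u = x + b * y" "v = x' + b * y'" "x \<in> P" "x' \<in> P" by auto
    then have "u + v = (x + x') + b * (y + y')" "x + x' \<in> P" by (auto simp: algebra_simps add_in)
    then show "u + v \<in> {x + b * y | x y. x \<in> P}" by blast
  next
    fix u v assume "u \<in> {x + b * y | x y. x \<in> P}"
    then obtain x y where "u = x + b * y" "x \<in> P" by auto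
    then have "v * u = v * x + b * (v * y)" "v * x \<in> P" by (auto simp: algebra_simps mult_in)
    then show "v * u \<in> {x + b * y | x y. x \<in> P}" by blast
  qed
qed

lemma ideal_cong_Union_chain:
  assumes "C \<noteq> {}" "\<And>I. I \<in> C \<Longrightarrow> ideal_cong I" "\<And>I J. I \<in> C \<Longrightarrow> J \<in> C \<Longrightarrow> I \<subseteq> J \<or> J \<subseteq> I"
  shows "ideal_cong (\<Union>C)"
proof
  show "0 \<in> \<Union>C" using assms(1,2) ideal_cong.zero_in by blast
  show "x + y \<in> \<Union>C" if xy: "x \<in> \<Union>C" "y \<in> \<Union>C" for x y
  proof -
    obtain I J where IJ: "I \<in> C" "J \<in> C" "x \<in> I" "y \<in> J" using xy by blast
    then obtain L where "L \<in> C" "x \<in> L" "y \<in> L" using assms(3)[OF IJ(1,2)] by blast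
    then show ?thesis using ideal_cong.add_in[OF assms(2)] by blast
  qed
  show "y * x \<in> \<Union>C" if "x \<in> \<Union>C" for x y
    using that ideal_cong.mult_in[OF assms(2)] by blast
qed

text \<open>Modulo \<open>p\<close> the equation would make \<open>g\<close> a multiple of the monic
  \<open>f\<close> of larger degree, so \<open>v\<close> vanishes modulo \<open>p\<close>. This is
  shown coefficient by coefficient from the top, as the coefficient of \<open>f * v\<close> at
  \<open>degree f + i\<close> is \<open>coeff v i\<close> plus terms with higher coefficients of
  \<open>v\<close>. Then \<open>p\<close> would divide the leading coefficient 1 of
  \<open>g\<close>.\<close>

lemma monic_degree_less_notin:
  fixes f g u v :: "int poly" and p :: nat
  assumes "prime p" "lead_coeff f = 1" "lead_coeff g = 1" "degree g < degree f"
  shows "g \<noteq> of_nat p * u + f * v"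
proof
  assume eq: "g = of_nat p * u + f * v"
  have p1: "\<not> int p dvd 1" using prime_gt_1_nat[OF assms(1)] by simp
  have co: "coeff (of_nat p * u) i = int p * coeff u i" for i
    by (simp add: of_nat_poly)
  have cog: "coeff g i = int p * coeff u i + coeff (f * v) i" for i
    using arg_cong[OF eq, of "\<lambda>h. coeff h i"] co[of i] by (simp only: coeff_add)
  have v: "int p dvd coeff v i" for i
  proof (induction "degree v - i" arbitrary: i rule: less_induct)
    case less
    show ?case
    proof (cases "i \<le> degree v")
      case False
      then show ?thesis by (simp add: coeff_eq_0)
    next
      case True
      have "int p dvd coeff f j * coeff v (degree f + i - j)" if "j \<le> degree f + i" "j \<noteq> degree f" for j
      proof (cases "j < degree f")
        case True
        then have "int p dvd coeff v (degree f + i - j)"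
        proof (cases "degree f + i - j \<le> degree v")
          case True
          then show ?thesis using less[of "degree f + i - j"] \<open>j < degree f\<close> \<open>i \<le> degree v\<close> by simp
        qed (simp add: coeff_eq_0)
        then show ?thesis by simp
      qed (use that in \<open>simp add: coeff_eq_0\<close>)
      then have S: "int p dvd (\<Sum>j\<in>{..degree f + i} - {degree f}. coeff f j * coeff v (degree f + i - j))"
        by (intro dvd_sum) auto
      have sp: "coeff (f * v) (degree f + i) =
          coeff v i + (\<Sum>j\<in>{..degree f + i} - {degree f}. coeff f j * coeff v (degree f + i - j))"
        unfolding coeff_mult by (subst sum.remove[of _ "degree f"]) (use assms(2) in simp_all)
      have "int p dvd coeff (f * v) (degree f + i)"
      proof -
        have "coeff g (degree f + i) = 0" using assms(4) by (simp add: coeff_eq_0)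
        then have "coeff (f * v) (degree f + i) = - (int p * coeff u (degree f + i))"
          using cog[of "degree f + i"] by linarith
        then show ?thesis by (simp only: dvd_minus_iff dvd_triv_left)
      qed
      then show ?thesis unfolding sp using S by (simp only: dvd_add_left_iff)
    qed
  qed
  have "int p dvd coeff (f * v) (degree g)"
    unfolding coeff_mult using v by (intro dvd_sum dvd_mult) auto
  then have "int p dvd lead_coeff g"
    unfolding cog[of "degree g"] by (intro dvd_add dvd_triv_left)
  with p1 show False unfolding assms(3) by (rule notE)
qed

text \<open>If \<open>a * b\<close> is in \<open>P\<close> but neither factor is, maximality puts
  \<open>g\<close> into both \<open>P + (a)\<close> and \<open>P + (b)\<close>. Then
  \<open>g * g\<close> is in \<open>P\<close>, hence \<open>g ^ k\<close>, and the congruence of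
  \<open>g ^ k\<close> and \<open>g\<close> gives the contradiction.\<close>

lemma prime_ideal_cong_maximal_avoiding:
  fixes P :: "'a::comm_ring_1 set"
  assumes "ideal_cong P" and gP: "g \<notin> P" and k: "2 \<le> k" and gk: "g ^ k - g \<in> P"
    and max: "\<And>J. ideal_cong J \<Longrightarrow> P \<subseteq> J \<Longrightarrow> g \<notin> J \<Longrightarrow> J = P"
  shows "prime_ideal_cong P"
proof -
  interpret ideal_cong P by fact
  have fermat: "g ^ k \<approx> g" using gk by (simp add: eqv_def)
  have g_in: "\<exists>x y. x \<in> P \<and> g = x + b * y" if b: "b \<notin> P" for b
  proof (rule ccontr)
    assume *: "\<not> ?thesis"
    define J where "J = {x + b * y | x y. x \<in> P}"
    have PJ: "P \<subseteq> J"
    proof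
      fix x assume "x \<in> P"
      then have "x = x + b * 0 \<and> x \<in> P" by simp
      then show "x \<in> J" unfolding J_def by blast
    qed
    moreover have "ideal_cong J" unfolding J_def by (rule ideal_cong_generated[OF ideal_cong_axioms])
    ultimately have "J = P" using * by (intro max) (auto simp: J_def)
    moreover have "b \<in> J" unfolding J_def
      by (rule CollectI, rule exI[of _ 0], rule exI[of _ 1]) auto
    ultimately show False using b by simp
  qed
  show ?thesis
  proof
    show "1 \<notin> P" using gP mult_in[of 1 g] by auto
    fix a b assume ab: "a * b \<in> P"
    show "a \<in> P \<or> b \<in> P"
    proof (rule ccontr)
      assume "\<not> ?thesis"
      then obtain x y x' y' where "x \<in> P" "x' \<in> P" and g: "g = x + a * y" "g = x' + b * y'"
        using g_in by meson
      have "g * g = (x + a * y) * g" using arg_cong[OF g(1), of "\<lambda>h. h * g"] .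
      also have "\<dots> = x * g + (a * y) * g" by (rule distrib_right)
      also have "(a * y) * g = (a * y) * (x' + b * y')" using arg_cong[OF g(2), of "\<lambda>h. a * y * h"] .
      also have "x * g + (a * y) * (x' + b * y') = x * g + (a * y) * x' + (a * b) * (y * y')"
        by (simp add: algebra_simps)
      also have "x * g + (a * y) * x' + (a * b) * (y * y') \<in> P"
        using mult_in'[OF \<open>x \<in> P\<close>] mult_in[OF \<open>x' \<in> P\<close>] mult_in'[OF ab] by (intro add_in)
      finally have gg: "g * g \<in> P" .
      have "g ^ k = (g * g) * g ^ (k - 2)"
        using k by (metis le_add_diff_inverse power2_eq_square power_add)
      also have "\<dots> \<in> P" using gg by (rule mult_in')
      finally have "g ^ k \<approx> 0" by (simp add: eqv_zero_iff)
      then have "g \<approx> 0" by (rule eqv_trans[OF eqv_sym[OF fermat]])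
      then show False using gP by (simp add: eqv_zero_iff)
    qed
  qed
qed

text \<open>The polynomial \<open>g\<close> below is the product of all \<open>X ^ p ^ d - X\<close> with \<open>0 < d < M\<close>. An ideal
  that contains \<open>p\<close> and \<open>X ^ p ^ M - X\<close> and is maximal among those not containing \<open>g\<close> is prime,
  because \<open>g ^ p ^ M\<close> is congruent to \<open>g\<close>, and \<open>X\<close> has \<open>M\<close> distinct conjugates modulo it.\<close>

lemma prime_ideal_avoiding_exists:
  assumes p: "prime p" and M: "M > 0"
  shows "\<exists>P :: int poly set. char_prime_ideal P p \<and> (\<forall>y. y ^ (p ^ M) - y \<in> P) \<and>
    (\<Prod>d\<in>{1..<M}. monom 1 (p ^ d) - monom 1 1) \<notin> P"
proof -
  have p2: "p \<ge> 2" using p by (rule prime_ge_2_nat)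
  define D :: "nat \<Rightarrow> int poly" where "D d = monom 1 (p ^ d) - monom 1 1" for d
  define f where "f = D M"
  define g where "g = (\<Prod>d\<in>{1..<M}. D d)"
  have D: "degree (D d) = p ^ d \<and> coeff (D d) (p ^ d) = 1" if "d > 0" for d
  proof -
    have "1 < p ^ d" using p2 that by (intro one_less_power) auto
    then have "degree (monom 1 1 :: int poly) < degree (monom 1 (p ^ d) :: int poly)"
      by (simp add: degree_monom_eq)
    then have "degree (D d) = p ^ d"
      unfolding D_def diff_conv_add_uminus
      by (subst degree_add_eq_left) (simp_all add: degree_monom_eq)
    moreover have "coeff (D d) (p ^ d) = 1" using \<open>1 < p ^ d\<close> by (simp add: D_def)
    ultimately show ?thesis by simp
  qed
  have deg_g: "degree g < p ^ M"
  proof -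
    have "degree g \<le> (\<Sum>d\<in>{1..<M}. degree (D d))"
      unfolding g_def by (rule order.trans[OF degree_prod_sum_le]) auto
    also have "\<dots> = (\<Sum>d\<in>{1..<M}. p ^ d)" by (rule sum.cong) (auto simp: D)
    also have "\<dots> < p ^ M" by (rule sum_powers_less[OF p2])
    finally show ?thesis .
  qed
  have lead_g: "lead_coeff g = 1"
    unfolding g_def lead_coeff_prod
    by (rule prod.neutral) (simp add: D)
  \<comment> \<open>The ideal generated by \<open>p\<close> and \<open>f\<close>; the summand
    \<open>0\<close> comes from adjoining \<open>p\<close> to the zero ideal first.\<close>
  define I0 where "I0 = {x + f * y | x y. x \<in> {0 + of_nat p * z | z. True}}"
  have I0: "ideal_cong I0"
  proof -
    have "ideal_cong {0 :: int poly}" by unfold_locales auto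
    from ideal_cong_generated[OF this, of "of_nat p"]
    have "ideal_cong {0 + of_nat p * z | z :: int poly. True}" by simp
    from ideal_cong_generated[OF this, of f] show ?thesis unfolding I0_def by simp
  qed
  have g_I0: "g \<notin> I0"
  proof
    assume "g \<in> I0"
    then obtain u v where "g = of_nat p * u + f * v" by (auto simp: I0_def)
    moreover have "lead_coeff f = 1" "degree g < degree f"
      using D[OF M] deg_g by (simp_all add: f_def)
    ultimately show False using monic_degree_less_notin[OF p _ lead_g] by blast
  qed
  have p_I0: "of_nat p \<in> I0" unfolding I0_def
    by (rule CollectI, rule exI[of _ "of_nat p"], rule exI[of _ 0]) (auto intro: exI[of _ 1])
  have f_I0: "f \<in> I0" unfolding I0_def
    by (rule CollectI, rule exI[of _ 0], rule exI[of _ 1]) auto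
  define \<A> where "\<A> = {I. ideal_cong I \<and> I0 \<subseteq> I \<and> g \<notin> I}"
  have "\<exists>P\<in>\<A>. \<forall>X\<in>\<A>. P \<subseteq> X \<longrightarrow> X = P"
  proof (rule subset_Zorn_nonempty)
    show "\<A> \<noteq> {}" using I0 g_I0 by (auto simp: \<A>_def)
    fix C assume C: "C \<noteq> {}" "subset.chain \<A> C"
    then have "ideal_cong (\<Union>C)"
      by (intro ideal_cong_Union_chain) (auto simp: subset_chain_def \<A>_def)
    then show "\<Union>C \<in> \<A>" using C by (fastforce simp: \<A>_def subset_chain_def)
  qed
  then obtain P where P: "P \<in> \<A>" and max: "\<And>J. J \<in> \<A> \<Longrightarrow> P \<subseteq> J \<Longrightarrow> J = P" by blast
  have I0P: "I0 \<subseteq> P" and gP: "g \<notin> P" and idP: "ideal_cong P" using P by (auto simp: \<A>_def)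
  have charP: "char_ideal_cong P p"
    using idP p p_I0 I0P by (auto simp: char_ideal_cong_def char_ideal_cong_axioms_def)
  have fermat: "y ^ (p ^ M) - y \<in> P" for y
    using fermat_int_poly[OF charP] f_I0 I0P by (auto simp: f_def D_def)
  have "prime_ideal_cong P"
  proof (rule prime_ideal_cong_maximal_avoiding)
    show "2 \<le> p ^ M" using p2 M self_le_power[of p M] by linarith
    fix J assume "ideal_cong J" "P \<subseteq> J" "g \<notin> J"
    then show "J = P" using I0P by (intro max) (auto simp: \<A>_def)
  qed (use idP gP fermat in auto)
  then have "char_prime_ideal P p"
    using idP charP by (simp add: char_prime_ideal_def)
  then show ?thesis using fermat gP unfolding g_def D_def by (intro exI[of _ P] conjI allI)
qed

text \<open>A factor \<open>X ^ p ^ d - X\<close> in \<open>P\<close> would put the whole product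
  into \<open>P\<close>, so \<open>X\<close> has \<open>M\<close> distinct conjugates and its power
  combinations give \<open>p ^ M\<close> classes. There are no more, because every class is a root
  of \<open>X ^ p ^ M - X\<close>.\<close>

lemma galois_cong_avoidingI:
  fixes P :: "int poly set"
  assumes "char_prime_ideal P p" and M: "M > 0" and frob: "\<And>y. y ^ (p ^ M) - y \<in> P"
    and gP: "(\<Prod>d\<in>{1..<M}. monom 1 (p ^ d) - monom 1 1) \<notin> P"
  shows "galois_cong P p M"
proof -
  interpret char_prime_ideal P p by fact
  have fermat: "y ^ (p ^ M) \<approx> y" for y using frob by (simp add: eqv_def)
  define X where "X = (monom 1 1 :: int poly)"
  have conj: "\<not> X ^ (p ^ d) \<approx> X" if "0 < d" "d < M" for d
  proof
    assume "X ^ (p ^ d) \<approx> X"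
    then have "monom 1 (p ^ d) - monom 1 1 \<in> P" by (simp add: eqv_def X_def monom_power)
    then show False using gP that by (subst (asm) prod.remove[of _ d]) (auto simp: mult_in')
  qed
  have pM: "p ^ M > 1" using prime_gt_1_nat[OF prime_p] M by (intro one_less_power)
  have fin: "finite (range rep)" and le: "card (range rep) \<le> p ^ M"
    by (rule card_power_fixed_le[OF pM]; simp add: fermat range_rep_eqv_iff)+
  have "p ^ M = card ((\<lambda>w. rep (\<Sum>i<M. of_nat (w ! i) * X ^ i)) ` words M p)"
    by (subst card_image[OF inj_on_power_combinations[OF conj]]) (simp_all add: card_words)
  also have "\<dots> \<le> card (range rep)" by (intro card_mono fin) auto
  finally have "card (range rep) = p ^ M" using le by simp
  then show ?thesis by unfold_locales (simp_all add: M fermat)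
qed

theorem galois_cong_exists:
  assumes "prime p" and "M > 0"
  shows "\<exists>P :: int poly set. galois_cong P p M"
proof -
  obtain P :: "int poly set" where P: "char_prime_ideal P p" "\<forall>y. y ^ (p ^ M) - y \<in> P"
    "(\<Prod>d\<in>{1..<M}. monom 1 (p ^ d) - monom 1 1) \<notin> P"
    using prime_ideal_avoiding_exists[OF assms] by (elim exE conjE)
  show ?thesis
    by (rule exI, rule galois_cong_avoidingI[OF P(1) assms(2) P(2)[rule_format] P(3)])
qed

section \<open>Subfields, dual bases and power sums\<close>

locale field_tower = galois_cong P p "t * m" for P :: "'a::comm_ring_1 set" and p t m :: nat
begin

abbreviation (input) q :: nat where "q \<equiv> p ^ t"

lemma t_pos: "t > 0" and m_pos: "m > 0"
  using M_pos by simp_all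

lemma q_gt_1: "q > 1"
  using prime_gt_1_nat[OF prime_p] t_pos by (intro one_less_power) auto

lemma q_power_m: "q ^ m = p ^ (t * m)"
  by (simp add: power_mult)

lemma fermat_q: "x ^ (q ^ m) \<approx> x"
  using fermat by (simp add: q_power_m)

lemma finite_range_rep: "finite (range rep)"
proof (rule ccontr)
  assume "infinite (range rep)"
  then show False using card_range_rep p_pos by (metis card.infinite less_numeral_extra(3) zero_less_power)
qed

definition Fq :: "'a set" where
  "Fq = {x \<in> range rep. x ^ q \<approx> x}"

lemma rep_in_Fq: "x ^ q \<approx> x \<Longrightarrow> rep x \<in> Fq"
  unfolding Fq_def using eqv_trans[OF eqv_power[OF rep_eqv]] eqv_trans eqv_sym[OF rep_eqv] by blast

lemma finite_Fq: "finite Fq"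
  unfolding Fq_def using finite_range_rep by simp

lemma tr_q_fixed: "tr q m x ^ q \<approx> tr q m x"
  by (rule tr_power_fixed[OF refl fermat_q])

text \<open>The upper bound counts the roots of \<open>X ^ q - X\<close>. For the lower bound the
  trace sends \<open>q ^ m\<close> elements into \<open>Fq\<close> with fibres of at most
  \<open>q ^ (m - 1)\<close> elements.\<close>

lemma card_Fq: "card Fq = q"
proof (rule antisym)
  show "card Fq \<le> q"
    by (rule card_power_fixed_le(2)[OF q_gt_1]) (auto simp: Fq_def range_rep_eqv_iff)
  have "q * q ^ (m - 1) = card (range rep)"
    using m_pos by (simp add: card_range_rep flip: q_power_m power_Suc)
  also have "\<dots> \<le> card Fq * q ^ (m - 1)"
  proof (rule card_le_mult_fibres[where f = "\<lambda>x. rep (tr q m x)"])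
    fix c
    show "card {x \<in> range rep. rep (tr q m x) = c} \<le> q ^ (m - 1)"
    proof (rule card_tr_fibre_le[OF q_gt_1 m_pos])
      fix x assume "x \<in> {x \<in> range rep. rep (tr q m x) = c}"
      then show "tr q m x \<approx> c" using eqv_sym[OF rep_eqv] by auto
    qed (auto simp: range_rep_eqv_iff)
  qed (auto simp: finite_range_rep finite_Fq intro: rep_in_Fq tr_q_fixed)
  finally show "q \<le> card Fq" using p_pos by (metis mult_le_cancel2 zero_less_power)
qed

text \<open>At most \<open>p ^ d\<close> elements are fixed by the \<open>p ^ d\<close>-th power
  map, and these numbers for \<open>0 < d < t\<close> add up to less than \<open>q\<close>. The
  powers of the remaining element form the basis.\<close>

lemma primitive_element_exists:
  "\<exists>x. x ^ q \<approx> x \<and> (\<forall>d. 0 < d \<and> d < t \<longrightarrow> \<not> x ^ (p ^ d) \<approx> x)"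
proof (rule ccontr)
  assume *: "\<not> ?thesis"
  have "Fq \<subseteq> (\<Union>d\<in>{1..<t}. {x \<in> Fq. x ^ (p ^ d) \<approx> x})"
  proof
    fix x assume x: "x \<in> Fq"
    then obtain d where "0 < d" "d < t" "x ^ (p ^ d) \<approx> x" using * by (auto simp: Fq_def)
    then show "x \<in> (\<Union>d\<in>{1..<t}. {x \<in> Fq. x ^ (p ^ d) \<approx> x})" using x by auto
  qed
  then have "card Fq \<le> card (\<Union>d\<in>{1..<t}. {x \<in> Fq. x ^ (p ^ d) \<approx> x})"
    by (intro card_mono) (auto simp: finite_Fq)
  also have "\<dots> \<le> (\<Sum>d\<in>{1..<t}. card {x \<in> Fq. x ^ (p ^ d) \<approx> x})"
    by (rule card_UN_le) simp
  also have "\<dots> \<le> (\<Sum>d\<in>{1..<t}. p ^ d)"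
  proof (rule sum_mono)
    fix d assume "d \<in> {1..<t}"
    then have "p ^ d > 1" using prime_gt_1_nat[OF prime_p] by (intro one_less_power) auto
    then show "card {x \<in> Fq. x ^ (p ^ d) \<approx> x} \<le> p ^ d"
      by (rule card_power_fixed_le(2)) (auto simp: Fq_def range_rep_eqv_iff)
  qed
  also have "\<dots> < q" by (rule sum_powers_less[OF prime_ge_2_nat[OF prime_p]])
  finally show False by (simp add: card_Fq)
qed

lemma tr_p_digit:
  assumes "x ^ (p ^ r) \<approx> x"
  shows "\<exists>c<p. tr p r x \<approx> of_nat c"
  using prime_field_of_nat[OF tr_power_fixed[of p 1 x r]] assms by simp

lemma mult_fixed: "x ^ k \<approx> x \<Longrightarrow> y ^ k \<approx> y \<Longrightarrow> (x * y) ^ k \<approx> x * y"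
  by (simp add: power_mult_distrib eqv_mult)

lemma power_fixed: "x ^ k \<approx> x \<Longrightarrow> (x ^ r) ^ k \<approx> x ^ r"
  using eqv_power[of "x ^ k" x r] by (simp add: power_mult[symmetric] mult.commute)

lemma sum_fixed: "(\<And>i. i \<in> A \<Longrightarrow> f i ^ (p ^ k) \<approx> f i) \<Longrightarrow> sum f A ^ (p ^ k) \<approx> sum f A"
  by (rule eqv_trans[OF frobenius_pow_sum eqv_sum])

text \<open>The dual basis is found by counting: the map sending \<open>u\<close> to the traces of \<open>u\<close> times the
  basis elements is injective by the Vandermonde argument.\<close>

lemma dual_bases_exist:
  "\<exists>B C. (\<forall>s. B s ^ q \<approx> B s) \<and> (\<forall>s<t. C s ^ q \<approx> C s) \<and>
     (\<forall>s<t. \<forall>r<t. tr p t (C s * B r) \<approx> of_nat (of_bool (r = s))) \<and>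
     (\<forall>u. u ^ q \<approx> u \<longrightarrow> (\<exists>c. u \<approx> (\<Sum>s<t. of_nat (c s) * B s)))"
proof -
  obtain x where xq: "x ^ q \<approx> x" and conj: "\<And>d. 0 < d \<Longrightarrow> d < t \<Longrightarrow> \<not> x ^ (p ^ d) \<approx> x"
    using primitive_element_exists by blast
  have Bq: "(x ^ s) ^ q \<approx> x ^ s" for s by (rule power_fixed[OF xq])
  have span: "\<exists>c. u \<approx> (\<Sum>s<t. of_nat (c s) * x ^ s)" if u: "u ^ q \<approx> u" for u
  proof -
    let ?F = "\<lambda>w. rep (\<Sum>i<t. of_nat (w ! i) * x ^ i)"
    have inj: "inj_on ?F (words t p)" by (rule inj_on_power_combinations[OF conj])
    have "?F ` words t p = Fq"
    proof (rule card_subset_eq[OF finite_Fq])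
      have "(of_nat c * x ^ i) ^ q \<approx> of_nat c * x ^ i" for c i
        using frobenius_of_int[of "int c" t] by (intro mult_fixed Bq) simp
      then show "?F ` words t p \<subseteq> Fq" by (auto intro!: rep_in_Fq sum_fixed)
      show "card (?F ` words t p) = card Fq" by (simp add: card_image[OF inj] card_words card_Fq)
    qed
    then obtain w where "rep u = ?F w" using rep_in_Fq[OF u] by (metis (no_types, lifting) imageE)
    then have "u \<approx> (\<Sum>i<t. of_nat (w ! i) * x ^ i)" by (simp add: rep_eq_iff)
    then show ?thesis by (rule exI[of _ "\<lambda>i. w ! i"])
  qed
  have digit: "\<exists>c<p. tr p t (u * x ^ r) \<approx> of_nat c" if "u \<in> Fq" for u r
    using that by (intro tr_p_digit mult_fixed Bq) (auto simp: Fq_def)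
  then obtain dig where dig: "\<And>u r. u \<in> Fq \<Longrightarrow> dig u r < p \<and> tr p t (u * x ^ r) \<approx> of_nat (dig u r)"
    by metis
  define G where "G u = map (dig u) [0..<t]" for u
  have inj: "inj_on G Fq"
  proof (rule inj_onI)
    fix u v assume u: "u \<in> Fq" and v: "v \<in> Fq" and "G u = G v"
    then have eq: "dig u r = dig v r" if "r < t" for r using that by (auto simp: G_def)
    \<comment> \<open>Vanishing traces against all \<open>x ^ r\<close> are a Vandermonde system:
      the nodes are the conjugates of \<open>x\<close>, the unknowns those of \<open>u - v\<close>.
      The exponent \<open>p ^ 0\<close> selects the unknown with index 0.\<close>
    have "(u - v) ^ (p ^ 0) \<approx> 0"
    proof (rule vandermonde_eqv_zero[where J = "{..<t}" and x = "\<lambda>j. x ^ (p ^ j)" and c = "\<lambda>j. (u - v) ^ (p ^ j)"])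
      fix i j assume "i \<in> {..<t}" "j \<in> {..<t}" "x ^ (p ^ i) \<approx> x ^ (p ^ j)"
      then show "i = j" using conjugates_distinct[OF conj] by auto
    next
      fix r assume "r < card {..<t}"
      then have r: "r < t" by simp
      have "(\<Sum>j<t. (u - v) ^ (p ^ j) * (x ^ (p ^ j)) ^ r) = tr p t ((u - v) * x ^ r)"
        unfolding tr_def by (intro sum.cong refl) (simp add: power_mult_distrib mult.commute flip: power_mult)
      also have "\<dots> = tr p t ((u - v) * x ^ r) + tr p t (v * x ^ r) - tr p t (v * x ^ r)" by simp
      also have "\<dots> \<approx> tr p t ((u - v) * x ^ r + v * x ^ r) - tr p t (v * x ^ r)"
        by (intro eqv_diff eqv_refl eqv_sym[OF tr_add[of p 1]]) simp
      also have "(u - v) * x ^ r + v * x ^ r = u * x ^ r" by (simp add: algebra_simps)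
      also have "tr p t (u * x ^ r) - tr p t (v * x ^ r) \<approx> of_nat (dig u r) - of_nat (dig v r)"
        using dig u v by (intro eqv_diff) auto
      finally show "(\<Sum>j<t. (u - v) ^ (p ^ j) * (x ^ (p ^ j)) ^ r) \<approx> 0" using eq[OF r] by simp
    qed (use t_pos in auto)
    then have "u \<approx> v" by (simp add: eqv_diff_zero_iff)
    then show "u = v" using u v by (auto simp: Fq_def range_rep_eqv_iff)
  qed
  \<comment> \<open>Injectivity and equal cardinalities make \<open>G\<close> onto; the preimages of
    the unit vectors are the dual basis.\<close>
  have "G ` Fq = words t p"
  proof (rule card_subset_eq)
    show "G ` Fq \<subseteq> words t p" using dig by (auto simp: G_def words_iff)
    show "card (G ` Fq) = card (words t p)" by (simp add: card_image[OF inj] card_words card_Fq)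
  qed simp
  moreover have "map (\<lambda>r. of_bool (r = s)) [0..<t] \<in> words t p" for s
    using prime_gt_1_nat[OF prime_p] by (auto simp: words_iff)
  ultimately have "\<exists>u\<in>Fq. G u = map (\<lambda>r. of_bool (r = s)) [0..<t]" for s
    by (metis (no_types, lifting) imageE)
  then obtain C where C: "\<And>s. C s \<in> Fq" "\<And>s. G (C s) = map (\<lambda>r. of_bool (r = s)) [0..<t]" by metis
  have "tr p t (C s * x ^ r) \<approx> of_nat (of_bool (r = s))" if "r < t" for s r
  proof -
    have "dig (C s) r = of_bool (r = s)" using C(2)[of s] that by (auto simp: G_def)
    then show ?thesis using dig[OF C(1), of s r] by metis
  qed
  moreover have "C s ^ q \<approx> C s" for s using C(1) by (auto simp: Fq_def)
  ultimately show ?thesis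
    using Bq span by (intro exI[of _ "\<lambda>s. x ^ s"] exI[of _ C] conjI allI impI)
qed

lemma unit_power_eqv_one: "\<not> x \<approx> 0 \<Longrightarrow> x ^ (q ^ m - 1) \<approx> 1"
proof (rule mult_eqv_cancel)
  have "x * x ^ (q ^ m - 1) = x ^ (q ^ m)"
    using p_pos by (simp flip: power_Suc)
  then show "x * x ^ (q ^ m - 1) \<approx> x * 1" using fermat_q[of x] by simp
qed

text \<open>For a unit \<open>z\<close> the products \<open>y * z\<close> run through all classes,
  so the trace would vanish on \<open>p ^ (t * m)\<close> classes, more than its kernel can
  hold.\<close>

lemma tr_nondegenerate:
  assumes "\<And>y. tr p (t * m) (y * z) \<approx> 0"
  shows "z \<approx> 0"
proof (rule ccontr)
  assume z: "\<not> z \<approx> 0"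
  have q2: "2 \<le> q ^ m" using one_less_power[OF q_gt_1 m_pos] by simp
  have "card (range rep) \<le> p ^ (t * m - 1)"
  proof (rule card_tr_fibre_le[where c = 0 and r = "t * m" and b = p])
    fix x
    \<comment> \<open>\<open>z ^ (q ^ m - 2)\<close> is the inverse of \<open>z\<close>.\<close>
    have "z ^ (q ^ m - 2) * z = z ^ (q ^ m - 1)"
      using q2 by (simp add: Suc_diff_Suc numeral_2_eq_2 flip: power_Suc2)
    then have "x * z ^ (q ^ m - 2) * z \<approx> x"
      using eqv_mult[OF eqv_refl unit_power_eqv_one[OF z], of x] by (simp add: mult.assoc)
    then have "x \<approx> (x * z ^ (q ^ m - 2)) * z" by (rule eqv_sym)
    then have "tr p (t * m) x \<approx> tr p (t * m) ((x * z ^ (q ^ m - 2)) * z)" by (rule tr_cong)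
    also have "\<dots> \<approx> 0" by (rule assms)
    finally show "tr p (t * m) x \<approx> 0" .
  qed (auto simp: range_rep_eqv_iff prime_gt_1_nat[OF prime_p] t_pos m_pos prime_gt_Suc_0_nat[OF prime_p])
  moreover have "p ^ (t * m - 1) < p ^ (t * m)"
    using M_pos prime_gt_1_nat[OF prime_p] by (intro power_strict_increasing) auto
  ultimately show False by (simp add: card_range_rep)
qed

lemma power_mod_units:
  assumes "\<not> x \<approx> 0" "a mod (q ^ m - 1) = b mod (q ^ m - 1)"
  shows "x ^ a \<approx> x ^ b"
proof -
  have *: "x ^ c \<approx> x ^ (c mod (q ^ m - 1))" for c
  proof -
    have "x ^ c = (x ^ (q ^ m - 1)) ^ (c div (q ^ m - 1)) * x ^ (c mod (q ^ m - 1))"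
      by (simp only: power_mult[symmetric] power_add[symmetric] mult_div_mod_eq)
    also have "\<dots> \<approx> 1 ^ (c div (q ^ m - 1)) * x ^ (c mod (q ^ m - 1))"
      by (intro eqv_mult eqv_power eqv_refl unit_power_eqv_one assms)
    finally show ?thesis by simp
  qed
  show ?thesis using eqv_trans[OF *[of a] eqv_sym[OF *[of b, folded assms(2)]]] .
qed

lemma card_units: "card (range rep - {rep 0}) = q ^ m - 1"
  using finite_range_rep by (simp add: card_range_rep q_power_m)

text \<open>Multiplication by a unit \<open>v\<close> permutes the units and so multiplies the sum
  by \<open>v ^ e\<close>. Some \<open>v\<close> has \<open>v ^ e\<close> incongruent to 1, since
  otherwise all \<open>q ^ m - 1\<close> units would be roots of \<open>X ^ d - 1\<close>, where
  \<open>d < q ^ m - 1\<close> is the reduced exponent.\<close>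

lemma sum_powers_units:
  assumes "\<not> q ^ m - 1 dvd e"
  shows "(\<Sum>u\<in>range rep - {rep 0}. u ^ e) \<approx> 0"
proof -
  define U where "U = range rep - {rep 0}"
  define d where "d = e mod (q ^ m - 1)"
  have q1: "q ^ m > 1" using one_less_power[OF q_gt_1 m_pos] .
  have d: "0 < d" "d < q ^ m - 1" using assms q1 by (auto simp: d_def dvd_eq_mod_eq_0)
  have U: "\<not> u \<approx> 0" if "u \<in> U" for u
  proof
    assume "u \<approx> 0"
    then have "rep u = rep 0" by (simp add: rep_eq_iff)
    then show False using that by (auto simp: U_def)
  qed
  have inj: "u = v" if "u \<in> U" "v \<in> U" "u \<approx> v" for u v
    using that by (auto simp: U_def range_rep_eqv_iff)
  have "\<exists>v\<in>U. \<not> v ^ e \<approx> 1"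
  proof (rule ccontr)
    assume "\<not> ?thesis"
    then have e: "v ^ e \<approx> 1" if "v \<in> U" for v using that by blast
    have "card U \<le> d"
    proof (rule card_roots_le(2)[where f = "monom 1 d - 1" and i = d])
      fix v assume v: "v \<in> U"
      have "v ^ d \<approx> v ^ e" by (rule power_mod_units[OF U[OF v]]) (simp add: d_def)
      also have "\<dots> \<approx> 1" by (rule e[OF v])
      finally show "poly (monom 1 d - 1) v \<approx> 0" by (simp add: poly_monom eqv_diff_zero_iff)
    qed (use d inj not_one_eqv_zero in \<open>auto intro!: degree_diff_le degree_monom_le\<close>)
    then show False using d card_units by (simp add: U_def)
  qed
  then obtain v where v: "v \<in> U" and ve: "\<not> v ^ e \<approx> 1" by blast
  define \<pi> where "\<pi> u = rep (v * u)" for u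
  have pi_U: "\<pi> u \<in> U" if "u \<in> U" for u
    using mult_eqv_zeroD[of v u] U[OF v] U[OF that] by (auto simp: \<pi>_def U_def rep_eq_iff)
  have pi_inj: "inj_on \<pi> U"
  proof (rule inj_onI)
    fix u w assume "u \<in> U" "w \<in> U" "\<pi> u = \<pi> w"
    then show "u = w"
      using mult_eqv_cancel[of v u w] U[OF v] inj by (auto simp: \<pi>_def rep_eq_iff)
  qed
  have "finite U" using finite_range_rep by (simp add: U_def)
  then have "\<pi> ` U = U" using pi_U by (intro endo_inj_surj pi_inj) auto
  then have bij: "bij_betw \<pi> U U" using pi_inj by (simp add: bij_betw_def)
  have "(\<Sum>u\<in>U. u ^ e) = (\<Sum>u\<in>U. \<pi> u ^ e)"
    using sum.reindex_bij_betw[OF bij, of "\<lambda>u. u ^ e"] by simp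
  also have "\<dots> \<approx> (\<Sum>u\<in>U. (v * u) ^ e)"
    by (intro eqv_sum eqv_power) (simp add: \<pi>_def rep_eqv)
  also have "\<dots> = v ^ e * (\<Sum>u\<in>U. u ^ e)" by (simp add: power_mult_distrib sum_distrib_left)
  finally have "v ^ e * (\<Sum>u\<in>U. u ^ e) \<approx> (\<Sum>u\<in>U. u ^ e)" by (rule eqv_sym)
  then have "(v ^ e - 1) * (\<Sum>u\<in>U. u ^ e) \<approx> 0"
    by (simp add: left_diff_distrib eqv_diff_zero_iff)
  then have "v ^ e - 1 \<approx> 0 \<or> (\<Sum>u\<in>U. u ^ e) \<approx> 0" by (rule mult_eqv_zeroD)
  then show ?thesis using ve by (simp add: U_def eqv_diff_zero_iff)
qed

end

section \<open>BCH codes over the prime field\<close>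

text \<open>The number of positive exponents that are charged a full element of the large
  field.\<close>

lemma card_non_multiples:
  assumes "q > 0"
  shows "card {a \<in> {1..r}. \<not> q dvd a} = r - r div q"
proof -
  have "{a \<in> {1..r}. q dvd a} = (\<lambda>k. q * k) ` {1..r div q}"
  proof (rule set_eqI, rule iffI)
    fix a assume a: "a \<in> {a \<in> {1..r}. q dvd a}"
    then obtain k where k: "a = q * k" by (auto elim: dvdE)
    then have "k \<le> r div q" using a assms by (simp add: less_eq_div_iff_mult_less_eq mult.commute)
    moreover have "k \<ge> 1" using a k by (cases k) auto
    ultimately show "a \<in> (\<lambda>k. q * k) ` {1..r div q}" using k by auto
  next
    fix a assume "a \<in> (\<lambda>k. q * k) ` {1..r div q}"
    then obtain k where "a = q * k" "k \<in> {1..r div q}" by blast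
    then have k: "a = q * k" "1 \<le> k" "k \<le> r div q" by simp_all
    then have "a \<le> r" using assms by (simp add: less_eq_div_iff_mult_less_eq mult.commute)
    then show "a \<in> {a \<in> {1..r}. q dvd a}" using k assms by auto
  qed
  then have "card {a \<in> {1..r}. q dvd a} = r div q"
    using assms by (simp add: card_image inj_on_def)
  moreover have "card ({1..r} - {a \<in> {1..r}. q dvd a}) = card {1..r} - card {a \<in> {1..r}. q dvd a}"
    by (rule card_Diff_subset) auto
  moreover have "{1..r} - {a \<in> {1..r}. q dvd a} = {a \<in> {1..r}. \<not> q dvd a}" by auto
  ultimately show ?thesis by simp
qed

lemma wt_eq_card:
  assumes "a \<in> words n p"
  shows "wt a = card {k. k < n \<and> a ! k \<noteq> 0}"
  using assms by (simp add: wt_def length_filter_conv_card words_iff)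

lemma card_support_diff_le:
  assumes "a \<in> words n p" "b \<in> words n p"
  shows "card {k. k < n \<and> \<not> int p dvd int (a ! k) - int (b ! k)} \<le> wt a + wt b"
proof -
  have "{k. k < n \<and> \<not> int p dvd int (a ! k) - int (b ! k)} \<subseteq>
      {k. k < n \<and> a ! k \<noteq> 0} \<union> {k. k < n \<and> b ! k \<noteq> 0}" by (auto intro!: gr0I)
  then have "card {k. k < n \<and> \<not> int p dvd int (a ! k) - int (b ! k)} \<le>
      card ({k. k < n \<and> a ! k \<noteq> 0} \<union> {k. k < n \<and> b ! k \<noteq> 0})"
    by (intro card_mono) auto
  also have "\<dots> \<le> wt a + wt b"
    unfolding wt_eq_card[OF assms(1)] wt_eq_card[OF assms(2)] by (rule card_Un_le)
  finally show ?thesis .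
qed

lemma words_eqI_dvd:
  assumes "a \<in> words n p" "b \<in> words n p" "\<And>k. k < n \<Longrightarrow> int p dvd int (a ! k) - int (b ! k)"
  shows "a = b"
  using assms by (auto simp: words_iff list_eq_iff_nth_eq mod_eq_dvd_iff[symmetric])

lemma mult_add_less_mult:
  fixes i n s t :: nat
  assumes "i < n" "s < t" shows "i * t + s < n * t"
proof -
  have "i * t + s < Suc i * t" using assms by simp
  also have "\<dots> \<le> n * t" using assms by (intro mult_le_mono) auto
  finally show ?thesis .
qed

locale code_positions = field_tower P p t m for P :: "'a::comm_ring_1 set" and p t m :: nat +
  fixes \<beta> \<gamma> \<xi> :: "nat \<Rightarrow> 'a" and n :: nat
  assumes beta_fixed: "\<beta> s ^ q \<approx> \<beta> s" and gamma_fixed: "s < t \<Longrightarrow> \<gamma> s ^ q \<approx> \<gamma> s"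
    and dual: "s < t \<Longrightarrow> r < t \<Longrightarrow> tr p t (\<gamma> s * \<beta> r) \<approx> of_nat (of_bool (r = s))"
    and span: "u ^ q \<approx> u \<Longrightarrow> \<exists>c. u \<approx> (\<Sum>s<t. of_nat (c s) * \<beta> s)"
    and n_def: "n = q ^ m - 1"
    and xi: "bij_betw \<xi> {..<n} (range rep - {rep 0})"
begin

section \<open>Coordinates with respect to the dual bases\<close>

lemma tr_of_int: "tr p r (of_int c * x) \<approx> of_int c * tr p r x"
  using tr_scale[of "of_int c" p r x] frobenius_of_int[of c 1] by simp

lemma tr_dual_sum:
  assumes "s < t"
  shows "tr p t (\<gamma> s * (\<Sum>r<t. of_int (c r) * \<beta> r)) \<approx> of_int (c s)"
    and "tr p t ((\<Sum>r<t. of_int (c r) * \<gamma> r) * \<beta> s) \<approx> of_int (c s)"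
proof -
  have "tr p t (\<gamma> s * (\<Sum>r<t. of_int (c r) * \<beta> r)) \<approx> (\<Sum>r<t. tr p t (of_int (c r) * (\<gamma> s * \<beta> r)))"
    using tr_sum[of p 1 t "\<lambda>r. of_int (c r) * (\<gamma> s * \<beta> r)" "{..<t}"]
    by (simp add: sum_distrib_left mult_ac)
  also have "\<dots> \<approx> (\<Sum>r<t. of_int (c r) * of_nat (of_bool (r = s)))"
    by (intro eqv_sum eqv_trans[OF tr_of_int] eqv_mult eqv_refl dual assms) auto
  also have "\<dots> = of_int (c s)" using assms by (simp add: of_bool_def if_distrib cong: if_cong)
  finally show "tr p t (\<gamma> s * (\<Sum>r<t. of_int (c r) * \<beta> r)) \<approx> of_int (c s)" .
  have "tr p t ((\<Sum>r<t. of_int (c r) * \<gamma> r) * \<beta> s) \<approx> (\<Sum>r<t. tr p t (of_int (c r) * (\<gamma> r * \<beta> s)))"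
    using tr_sum[of p 1 t "\<lambda>r. of_int (c r) * (\<gamma> r * \<beta> s)" "{..<t}"]
    by (simp add: sum_distrib_right mult.assoc)
  also have "\<dots> \<approx> (\<Sum>r<t. of_int (c r) * of_nat (of_bool (s = r)))"
    by (intro eqv_sum eqv_trans[OF tr_of_int] eqv_mult eqv_refl dual assms) auto
  also have "\<dots> = of_int (c s)" using assms by (simp add: of_bool_def if_distrib cong: if_cong)
  finally show "tr p t ((\<Sum>r<t. of_int (c r) * \<gamma> r) * \<beta> s) \<approx> of_int (c s)" .
qed

lemma tr_p_zero: "x \<approx> 0 \<Longrightarrow> tr p r x \<approx> 0"
  using eqv_trans[OF tr_cong tr_of_int[of r 0 0, simplified]] by simp

lemma basis_independent:
  assumes "s < t"
  shows "(\<Sum>r<t. of_int (c r) * \<beta> r) \<approx> 0 \<Longrightarrow> int p dvd c s"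
    and "(\<Sum>r<t. of_int (c r) * \<gamma> r) \<approx> 0 \<Longrightarrow> int p dvd c s"
proof -
  assume "(\<Sum>r<t. of_int (c r) * \<beta> r) \<approx> 0"
  then have "of_int (c s) \<approx> 0"
    using eqv_trans[OF eqv_sym[OF tr_dual_sum(1)[OF assms]] tr_p_zero[OF eqv_mult_zero(2)]] by blast
  then show "int p dvd c s" by (simp add: of_int_eqv_zero_iff)
next
  assume "(\<Sum>r<t. of_int (c r) * \<gamma> r) \<approx> 0"
  then have "of_int (c s) \<approx> 0"
    using eqv_trans[OF eqv_sym[OF tr_dual_sum(2)[OF assms]] tr_p_zero[OF eqv_mult_zero(1)]] by blast
  then show "int p dvd c s" by (simp add: of_int_eqv_zero_iff)
qed

lemma tr_p_gamma:
  assumes "s < t"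
  shows "tr p (t * m) (\<gamma> s * x) \<approx> tr p t (\<gamma> s * tr q m x)"
  using eqv_trans[OF tr_tower[of t m "\<gamma> s * x"] tr_cong[OF tr_scale[OF gamma_fixed[OF assms]]]] .

text \<open>The coordinates with respect to \<open>\<beta>\<close> are the traces against
  \<open>\<gamma>\<close>, by duality. This reassembles the digits of a trace codeword into a field
  element.\<close>

lemma dual_expansion:
  assumes "u ^ q \<approx> u"
  shows "(\<Sum>s<t. tr p t (\<gamma> s * u) * \<beta> s) \<approx> u"
proof -
  obtain c where c: "u \<approx> (\<Sum>s<t. of_nat (c s) * \<beta> s)" using span[OF assms] by blast
  have "(\<Sum>s<t. tr p t (\<gamma> s * u) * \<beta> s) \<approx> (\<Sum>s<t. of_int (int (c s)) * \<beta> s)"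
  proof (intro eqv_sum eqv_mult eqv_refl)
    fix s assume "s \<in> {..<t}"
    then have s: "s < t" by simp
    have "tr p t (\<gamma> s * u) \<approx> tr p t (\<gamma> s * (\<Sum>r<t. of_int (int (c r)) * \<beta> r))"
      using c by (intro tr_cong eqv_mult eqv_refl) simp
    also have "\<dots> \<approx> of_int (int (c s))" by (rule tr_dual_sum(1)[OF s])
    finally show "tr p t (\<gamma> s * u) \<approx> of_int (int (c s))" .
  qed
  also have "\<dots> \<approx> u" using eqv_sym[OF c] by simp
  finally show ?thesis .
qed

lemma xi_unit: "i < n \<Longrightarrow> \<not> \<xi> i \<approx> 0"
proof
  assume i: "i < n" and "\<xi> i \<approx> 0"
  then have "rep (\<xi> i) = rep 0" by (simp add: rep_eq_iff)
  moreover have "\<xi> i \<in> range rep" "\<xi> i \<noteq> rep 0" using bij_betwE[OF xi] i by auto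
  ultimately show False by auto
qed

lemma xi_inj: "i < n \<Longrightarrow> j < n \<Longrightarrow> \<xi> i \<approx> \<xi> j \<Longrightarrow> i = j"
proof -
  assume *: "i < n" "j < n" "\<xi> i \<approx> \<xi> j"
  then have "\<xi> i \<in> range rep" "\<xi> j \<in> range rep" using bij_betwE[OF xi] by auto
  then have "\<xi> i = \<xi> j" using *(3) by (simp add: range_rep_eqv_iff)
  then show "i = j" using inj_onD[OF bij_betw_imp_inj_on[OF xi]] *(1,2) by simp
qed

lemma xi_power_mod: "i < n \<Longrightarrow> a mod n = b mod n \<Longrightarrow> \<xi> i ^ a \<approx> \<xi> i ^ b"
  using power_mod_units[OF xi_unit] by (simp add: n_def)

lemma sum_xi_power: "\<not> n dvd e \<Longrightarrow> (\<Sum>i<n. \<xi> i ^ e) \<approx> 0"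
  using sum.reindex_bij_betw[OF xi, of "\<lambda>u. u ^ e"] sum_powers_units[of e] by (simp add: n_def)

text \<open>The field symbol at position \<open>i\<close>, read from its \<open>t\<close>
  consecutive digits. The basis is a parameter because flips use \<open>\<beta>\<close> and phase
  shifts use \<open>\<gamma>\<close>; digits are integers so that differences of words can be
  inserted.\<close>

definition block :: "(nat \<Rightarrow> 'a) \<Rightarrow> (nat \<Rightarrow> int) \<Rightarrow> nat \<Rightarrow> 'a" where
  "block B y i = (\<Sum>s<t. of_int (y (i * t + s)) * B s)"

definition syndrome :: "(nat \<Rightarrow> 'a) \<Rightarrow> nat \<Rightarrow> (nat \<Rightarrow> int) \<Rightarrow> 'a" where
  "syndrome B a y = (\<Sum>i<n. block B y i * \<xi> i ^ a)"

lemma syndrome_add: "syndrome B a (\<lambda>k. y k + z k) = syndrome B a y + syndrome B a z"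
  and syndrome_diff: "syndrome B a (\<lambda>k. y k - z k) = syndrome B a y - syndrome B a z"
  by (simp_all add: syndrome_def block_def sum.distrib sum_subtractf algebra_simps)

lemma syndrome_cong:
  assumes "\<And>k. k < n * t \<Longrightarrow> int p dvd y k - z k"
  shows "syndrome B a y \<approx> syndrome B a z"
  unfolding syndrome_def block_def
  by (intro eqv_sum eqv_mult eqv_refl of_int_eqvI assms mult_add_less_mult) auto

text \<open>At most \<open>r\<close> nonzero digits lie in at most \<open>r\<close> blocks, and the
  \<open>r\<close> consecutive power sums form a Vandermonde system for these blocks. Once all
  blocks vanish, independence of the basis returns to the digits.\<close>

lemma bch_bound:
  assumes indep: "\<And>c s. (\<Sum>r<t. of_int (c r) * B r) \<approx> 0 \<Longrightarrow> s < t \<Longrightarrow> int p dvd c s"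
    and zeros: "\<And>a. a0 \<le> a \<Longrightarrow> a < a0 + r \<Longrightarrow> syndrome B a y \<approx> 0"
    and supp: "card {k. k < n * t \<and> \<not> int p dvd y k} \<le> r" and k: "k < n * t"
  shows "int p dvd y k"
proof -
  define J where "J = {i. i < n \<and> \<not> block B y i \<approx> 0}"
  have finJ: "finite J" by (simp add: J_def)
  have "J \<subseteq> (\<lambda>k. k div t) ` {k. k < n * t \<and> \<not> int p dvd y k}"
  proof
    fix i assume i: "i \<in> J"
    have "\<exists>s<t. \<not> int p dvd y (i * t + s)"
    proof (rule ccontr)
      assume "\<not> ?thesis"
      then have "block B y i \<approx> 0" unfolding block_def
        by (intro eqv_sum_zero eqv_mult_zero(1) of_int_dvd_eqv_zero) auto
      then show False using i by (simp add: J_def)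
    qed
    then obtain s where s: "s < t" "\<not> int p dvd y (i * t + s)" by blast
    moreover have "i * t + s < n * t" using i s by (intro mult_add_less_mult) (auto simp: J_def)
    moreover have "(i * t + s) div t = i" using s by simp
    ultimately show "i \<in> (\<lambda>k. k div t) ` {k. k < n * t \<and> \<not> int p dvd y k}"
      by (intro image_eqI[of _ _ "i * t + s"]) auto
  qed
  then have "card J \<le> card {k. k < n * t \<and> \<not> int p dvd y k}" by (intro surj_card_le) auto
  with supp have cardJ: "card J \<le> r" by simp
  \<comment> \<open>The factor \<open>\<xi> i ^ a0\<close> is absorbed into the unknowns so that the
    exponents start at 0; it is a unit and is removed afterwards.\<close>
  have "block B y i * \<xi> i ^ a0 \<approx> 0" if i: "i \<in> J" for i
  proof (rule vandermonde_eqv_zero[OF finJ, where x = \<xi> and c = "\<lambda>i. block B y i * \<xi> i ^ a0"])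
    fix i j assume "i \<in> J" "j \<in> J" "\<xi> i \<approx> \<xi> j"
    then show "i = j" using xi_inj by (auto simp: J_def)
  next
    fix r' assume "r' < card J"
    have "(\<Sum>i<n. block B y i * \<xi> i ^ (a0 + r')) =
        (\<Sum>i\<in>J. block B y i * \<xi> i ^ (a0 + r')) + (\<Sum>i\<in>{..<n} - J. block B y i * \<xi> i ^ (a0 + r'))"
      by (subst add.commute, rule sum.subset_diff) (auto simp: J_def)
    moreover have "(\<Sum>i\<in>{..<n} - J. block B y i * \<xi> i ^ (a0 + r')) \<approx> 0"
      by (intro eqv_sum_zero eqv_mult_zero(1)) (auto simp: J_def)
    moreover have "(\<Sum>i<n. block B y i * \<xi> i ^ (a0 + r')) \<approx> 0"
      using zeros[of "a0 + r'"] \<open>r' < card J\<close> cardJ by (simp add: syndrome_def)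
    ultimately have "(\<Sum>i\<in>J. block B y i * \<xi> i ^ (a0 + r')) \<approx> 0"
      using diff_in unfolding eqv_zero_iff by fastforce
    then show "(\<Sum>i\<in>J. block B y i * \<xi> i ^ a0 * \<xi> i ^ r') \<approx> 0"
      by (simp add: power_add mult.assoc)
  qed (rule i)
  then have "i \<notin> J" for i
    using mult_eqv_zeroD[of "block B y i" "\<xi> i ^ a0"] power_eqv_zeroD[of "\<xi> i" a0] xi_unit[of i]
    unfolding J_def by blast
  then have "J = {}" by blast
  moreover have kt: "k div t < n" "k mod t < t"
    using k t_pos by (simp_all add: less_mult_imp_div_less)
  ultimately have "block B y (k div t) \<approx> 0" by (auto simp: J_def)
  then have "int p dvd y (k div t * t + k mod t)"
    unfolding block_def by (rule indep) (rule kt)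
  then show ?thesis by simp
qed

text \<open>The digits and the basis are fixed by the \<open>q\<close>-th power map, so only the
  exponent of \<open>\<xi>\<close> changes.\<close>

lemma syndrome_frobenius:
  assumes B: "\<And>s. s < t \<Longrightarrow> B s ^ q \<approx> B s"
  shows "syndrome B a y ^ q \<approx> syndrome B (a * q) y"
proof -
  have "syndrome B a y ^ q \<approx> (\<Sum>i<n. (block B y i * \<xi> i ^ a) ^ q)"
    unfolding syndrome_def by (rule frobenius_pow_sum)
  also have "\<dots> \<approx> syndrome B (a * q) y"
    unfolding syndrome_def power_mult_distrib power_mult[symmetric] block_def
    by (intro eqv_sum eqv_mult eqv_refl sum_fixed mult_fixed frobenius_of_int B) auto
  finally show ?thesis .
qed

lemma syndrome_exponent_cong:
  assumes "a mod n = b mod n"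
  shows "syndrome B a y \<approx> syndrome B b y"
  unfolding syndrome_def using assms by (intro eqv_sum eqv_mult eqv_refl xi_power_mod) auto

text \<open>Since \<open>h * q\<close> and \<open>h\<close> agree modulo \<open>n\<close>, the
  Frobenius acts on the shifted exponent \<open>h + a\<close> as it does on \<open>a\<close>: it
  multiplies \<open>a\<close> by \<open>q\<close> and leaves the shift alone.\<close>

lemma frobenius_shift_mod:
  assumes "n dvd h * (q - 1)"
  shows "((h + a) * q) mod n = (h + a * q) mod n"
proof -
  have "h * q = h + h * (q - 1)" using q_gt_1 by (simp add: algebra_simps)
  moreover obtain k where "h * (q - 1) = n * k" using assms by (auto elim: dvdE)
  ultimately have "(h + a) * q = (h + a * q) + n * k" by (simp add: distrib_right)
  then show ?thesis by simp
qed

lemma syndrome_shift_fixed: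
  assumes "n dvd h * (q - 1)" "\<And>s. s < t \<Longrightarrow> B s ^ q \<approx> B s"
  shows "syndrome B h y ^ q \<approx> syndrome B h y"
  using eqv_trans[OF syndrome_frobenius[of B h y, OF assms(2)] syndrome_exponent_cong]
    frobenius_shift_mod[OF assms(1), of 0] by simp

lemma syndrome_zero_multiples:
  assumes h: "n dvd h * (q - 1)" and B: "\<And>s. s < t \<Longrightarrow> B s ^ q \<approx> B s" and e: "e \<le> 1"
    and zeros: "\<And>a. e \<le> a \<Longrightarrow> a \<le> r \<Longrightarrow> a = 0 \<or> \<not> q dvd a \<Longrightarrow> syndrome B (h + a) y \<approx> 0"
    and a: "e \<le> a" "a \<le> r"
  shows "syndrome B (h + a) y \<approx> 0"
  using a
proof (induction a rule: less_induct)
  case (less a)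
  show ?case
  proof (cases "a = 0 \<or> \<not> q dvd a")
    case True
    then show ?thesis using zeros less.prems by blast
  next
    case False
    then obtain b where "a = q * b" by (metis dvdE)
    then have b: "a = b * q" by (simp only: mult.commute)
    \<comment> \<open>Here \<open>e \<le> 1\<close> matters: the quotient \<open>b\<close> does not
      fall below the range \<open>e..r\<close>.\<close>
    have b1: "1 \<le> b" using False b by (cases b) auto
    have "b < a" using b b1 q_gt_1 by simp
    then have "syndrome B (h + b) y \<approx> 0" using less.IH[of b] less.prems b1 e by simp
    have "syndrome B (h + a) y \<approx> syndrome B ((h + b) * q) y"
      using frobenius_shift_mod[OF h, of b] by (intro syndrome_exponent_cong) (simp add: b)
    also have "\<dots> \<approx> syndrome B (h + b) y ^ q" by (rule eqv_sym[OF syndrome_frobenius[OF B]])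
    also have "\<dots> \<approx> 0 ^ q" by (intro eqv_power) fact
    finally show ?thesis using p_pos by (simp add: power_0_left)
  qed
qed

text \<open>The \<open>r + 1\<close> consecutive exponents give distance at least
  \<open>r + 2\<close>. The redundant multiples of \<open>q\<close> are kept in the condition so
  that the BCH bound applies as it stands; only the counting discards them.\<close>

definition check_code :: "nat \<Rightarrow> nat \<Rightarrow> nat list set" where
  "check_code h r = {w \<in> words (n * t) p. \<forall>a\<le>r. syndrome \<beta> (h + a) (\<lambda>k. int (w ! k)) \<approx> 0}"

text \<open>The exponent 0 is kept although \<open>q\<close> divides it: it equals
  \<open>0 * q\<close>, so no smaller exponent implies it.\<close>

definition exponents :: "nat \<Rightarrow> nat \<Rightarrow> nat set" where
  "exponents e r = {b \<in> {e..r}. b = 0 \<or> \<not> q dvd b}"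

definition eval_sum :: "nat set \<Rightarrow> (nat \<Rightarrow> 'a) \<Rightarrow> nat \<Rightarrow> 'a" where
  "eval_sum E l i = (\<Sum>b\<in>E. l b * \<xi> i ^ b)"

text \<open>These digits are the \<open>\<beta>\<close>-coordinates of
  \<open>tr q m (eval_sum E l i)\<close>, contracted to one absolute trace by transitivity. The
  absolute form is the one that \<open>tr_nondegenerate\<close> can test.\<close>

definition encodes :: "nat set \<Rightarrow> (nat \<Rightarrow> 'a) \<Rightarrow> nat list \<Rightarrow> bool" where
  "encodes E l w \<longleftrightarrow> (\<forall>i<n. \<forall>s<t. of_nat (w ! (i * t + s)) \<approx> tr p (t * m) (\<gamma> s * eval_sum E l i))"

text \<open>Delsarte's description of the dual of a subfield subcode by traces of evaluated
  polynomials. Only one direction is used: words orthogonal to all of these have vanishing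
  \<open>\<gamma>\<close>-syndromes.\<close>

definition trace_code :: "nat \<Rightarrow> nat \<Rightarrow> nat list set" where
  "trace_code e r = {w \<in> words (n * t) p. \<exists>l. encodes (exponents e r) l w}"

section \<open>Closure and orthogonality of the two codes\<close>

lemma encodes_exists: "\<exists>w\<in>words (n * t) p. encodes E l w"
proof -
  have "\<exists>c<p. tr p (t * m) x \<approx> of_nat c" for x by (rule tr_p_digit[OF fermat])
  then obtain dig where dig: "\<And>x. dig x < p \<and> tr p (t * m) x \<approx> of_nat (dig x)" by metis
  define w where "w = map (\<lambda>k. dig (\<gamma> (k mod t) * eval_sum E l (k div t))) [0..<n * t]"
  have "w \<in> words (n * t) p" using dig by (simp add: w_def words_iff)
  moreover have "encodes E l w"
    unfolding encodes_def
  proof (intro allI impI)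
    fix i s assume "i < n" "s < t"
    then have "w ! (i * t + s) = dig (\<gamma> s * eval_sum E l i)"
      using mult_add_less_mult[of i n s t] by (simp add: w_def)
    then show "of_nat (w ! (i * t + s)) \<approx> tr p (t * m) (\<gamma> s * eval_sum E l i)"
      using dig eqv_sym by metis
  qed
  ultimately show ?thesis by blast
qed

text \<open>The scalar \<open>e\<close> is 1 for sums and -1 for differences of words.\<close>

lemma eqv_encodesI:
  assumes "u \<in> words (n * t) p" "encodes E l u" "encodes E l' v" "w \<in> words (n * t) p"
    and w: "\<And>k. k < n * t \<Longrightarrow> int p dvd int (w ! k) - (int (u ! k) + e * int (v ! k))"
  shows "encodes E (\<lambda>b. l b + of_int e * l' b) w"
  unfolding encodes_def
proof (intro allI impI)
  fix i s assume i: "i < n" and s: "s < t"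
  let ?k = "i * t + s"
  have "(of_nat (w ! ?k) :: 'a) = of_int (int (w ! ?k))" by simp
  also have "\<dots> \<approx> of_int (int (u ! ?k) + e * int (v ! ?k))"
    by (intro of_int_eqvI w mult_add_less_mult i s)
  also have "\<dots> = of_nat (u ! ?k) + of_int e * of_nat (v ! ?k)" by simp
  also have "\<dots> \<approx> tr p (t * m) (\<gamma> s * eval_sum E l i) + of_int e * tr p (t * m) (\<gamma> s * eval_sum E l' i)"
    using assms(2,3) i s unfolding encodes_def by (intro eqv_add eqv_mult eqv_refl) auto
  also have "\<dots> \<approx> tr p (t * m) (\<gamma> s * eval_sum E l i) + tr p (t * m) (of_int e * (\<gamma> s * eval_sum E l' i))"
    by (intro eqv_add eqv_refl eqv_sym[OF tr_of_int])
  also have "\<dots> \<approx> tr p (t * m) (\<gamma> s * eval_sum E l i + of_int e * (\<gamma> s * eval_sum E l' i))"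
    by (rule eqv_sym[OF tr_add[of p 1]]) simp
  also have "\<gamma> s * eval_sum E l i + of_int e * (\<gamma> s * eval_sum E l' i) =
      \<gamma> s * eval_sum E (\<lambda>b. l b + of_int e * l' b) i"
    by (simp add: eval_sum_def distrib_left distrib_right sum.distrib sum_distrib_left mult_ac)
  finally show "of_nat (w ! ?k) \<approx> tr p (t * m) (\<gamma> s * eval_sum E (\<lambda>b. l b + of_int e * l' b) i)" .
qed

lemma trace_code_add:
  assumes "u \<in> trace_code e r" "v \<in> trace_code e r"
  shows "word_add p u v \<in> trace_code e r" "word_sub p u v \<in> trace_code e r"
proof -
  obtain l l' where *: "u \<in> words (n * t) p" "v \<in> words (n * t) p"
    "encodes (exponents e r) l u" "encodes (exponents e r) l' v"
    using assms by (auto simp: trace_code_def)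
  have "encodes (exponents e r) (\<lambda>b. l b + of_int 1 * l' b) (word_add p u v)"
    using word_add_int_cong[OF *(1,2)] word_add_in_words[OF p_pos *(1,2)]
    by (intro eqv_encodesI[OF *(1,3,4)]) auto
  then show "word_add p u v \<in> trace_code e r"
    using word_add_in_words[OF p_pos *(1,2)] by (auto simp: trace_code_def)
  have "encodes (exponents e r) (\<lambda>b. l b + of_int (-1) * l' b) (word_sub p u v)"
    using word_sub_int_cong[OF *(1,2)] word_sub_in_words[OF p_pos *(1,2)]
    by (intro eqv_encodesI[OF *(1,3,4)]) auto
  then show "word_sub p u v \<in> trace_code e r"
    using word_sub_in_words[OF p_pos *(1,2)] by (auto simp: trace_code_def)
qed

lemma syndrome_word_add:
  assumes "u \<in> words (n * t) p" "v \<in> words (n * t) p"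
  shows "syndrome B a (\<lambda>k. int (word_add p u v ! k)) \<approx>
      syndrome B a (\<lambda>k. int (u ! k)) + syndrome B a (\<lambda>k. int (v ! k))"
    and "syndrome B a (\<lambda>k. int (word_sub p u v ! k)) \<approx>
      syndrome B a (\<lambda>k. int (u ! k)) - syndrome B a (\<lambda>k. int (v ! k))"
  unfolding syndrome_add[symmetric] syndrome_diff[symmetric]
  using word_add_int_cong[OF assms] word_sub_int_cong[OF assms] by (auto intro!: syndrome_cong)

lemma check_code_add:
  assumes "u \<in> check_code h r" "v \<in> check_code h r"
  shows "word_add p u v \<in> check_code h r"
proof -
  have uv: "u \<in> words (n * t) p" "v \<in> words (n * t) p" using assms by (auto simp: check_code_def)
  have "syndrome \<beta> (h + a) (\<lambda>k. int (word_add p u v ! k)) \<approx> 0" if "a \<le> r" for a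
  proof -
    have "syndrome \<beta> (h + a) (\<lambda>k. int (word_add p u v ! k)) \<approx>
      syndrome \<beta> (h + a) (\<lambda>k. int (u ! k)) + syndrome \<beta> (h + a) (\<lambda>k. int (v ! k))"
      by (rule syndrome_word_add(1)[OF uv])
    also have "\<dots> \<approx> 0 + 0" using assms that by (intro eqv_add) (auto simp: check_code_def)
    finally show ?thesis by simp
  qed
  then show ?thesis using word_add_in_words[OF p_pos uv] by (simp add: check_code_def)
qed

text \<open>The block at \<open>i\<close> of a trace codeword is the trace of a polynomial value.
  Expanding that trace writes the syndrome at \<open>h + a\<close> as a combination of power sums
  with exponents \<open>h + a + b * q ^ j\<close>, none divisible by \<open>n\<close>.\<close>

lemma trace_code_subset_check_code:
  assumes orth: "\<And>a b j. a \<le> r1 \<Longrightarrow> e \<le> b \<Longrightarrow> b \<le> r2 \<Longrightarrow> j < m \<Longrightarrow> \<not> n dvd h + a + b * q ^ j"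
  shows "trace_code e r2 \<subseteq> check_code h r1"
proof
  fix w assume w: "w \<in> trace_code e r2"
  define E where "E = exponents e r2"
  obtain l where ww: "w \<in> words (n * t) p" and l: "encodes E l w"
    using w by (auto simp: trace_code_def E_def)
  define L where "L = eval_sum E l"
  have block: "block \<beta> (\<lambda>k. int (w ! k)) i \<approx> tr q m (L i)" if i: "i < n" for i
  proof -
    have "block \<beta> (\<lambda>k. int (w ! k)) i \<approx> (\<Sum>s<t. tr p t (\<gamma> s * tr q m (L i)) * \<beta> s)"
      unfolding block_def
    proof (intro eqv_sum eqv_mult eqv_refl)
      fix s assume "s \<in> {..<t}"
      then have s: "s < t" by simp
      have "of_int (int (w ! (i * t + s))) \<approx> tr p (t * m) (\<gamma> s * L i)"
        using l i s by (simp add: encodes_def L_def)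
      also have "\<dots> \<approx> tr p t (\<gamma> s * tr q m (L i))" by (rule tr_p_gamma[OF s])
      finally show "of_int (int (w ! (i * t + s))) \<approx> tr p t (\<gamma> s * tr q m (L i))" .
    qed
    also have "\<dots> \<approx> tr q m (L i)" by (rule dual_expansion[OF tr_q_fixed])
    finally show ?thesis .
  qed
  have "syndrome \<beta> (h + a) (\<lambda>k. int (w ! k)) \<approx> 0" if a: "a \<le> r1" for a
  proof -
    have "syndrome \<beta> (h + a) (\<lambda>k. int (w ! k)) \<approx> (\<Sum>i<n. tr q m (L i) * \<xi> i ^ (h + a))"
      unfolding syndrome_def by (intro eqv_sum eqv_mult eqv_refl block) auto
    also have "\<dots> \<approx> (\<Sum>i<n. (\<Sum>j<m. \<Sum>b\<in>E. (l b * \<xi> i ^ b) ^ (q ^ j)) * \<xi> i ^ (h + a))"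
      unfolding tr_def L_def eval_sum_def
      by (intro eqv_sum eqv_mult eqv_refl) (simp add: frobenius_pow_sum flip: power_mult)
    also have "\<dots> = (\<Sum>i<n. \<Sum>j<m. \<Sum>b\<in>E. l b ^ (q ^ j) * \<xi> i ^ (h + a + b * q ^ j))"
      by (simp add: sum_distrib_right sum_distrib_left power_mult_distrib power_add power_mult mult_ac)
    also have "\<dots> = (\<Sum>j<m. \<Sum>i<n. \<Sum>b\<in>E. l b ^ (q ^ j) * \<xi> i ^ (h + a + b * q ^ j))"
      by (rule sum.swap)
    also have "\<dots> = (\<Sum>j<m. \<Sum>b\<in>E. l b ^ (q ^ j) * (\<Sum>i<n. \<xi> i ^ (h + a + b * q ^ j)))"
      unfolding sum_distrib_left by (intro sum.cong refl sum.swap)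
    also have "\<dots> \<approx> 0"
      using orth a by (intro eqv_sum_zero eqv_mult_zero(2) sum_xi_power) (auto simp: E_def exponents_def)
    finally show ?thesis .
  qed
  then show "w \<in> check_code h r1" using ww by (simp add: check_code_def)
qed

text \<open>Subtracting one fixed member maps a fibre of the syndrome map injectively into the code.
  The possible values number \<open>q\<close> for the first exponent, whose syndrome lies in
  \<open>Fq\<close>, and \<open>q ^ m\<close> for each positive exponent not divisible by
  \<open>q\<close>.\<close>

lemma card_check_code:
  assumes h: "n dvd h * (q - 1)"
  shows "p ^ (n * t) \<le> q * (q ^ m) ^ (r - r div q) * card (check_code h r)"
proof -
  define A where "A = {a \<in> {1..r}. \<not> q dvd a}"
  define f where "f w = (rep (syndrome \<beta> h (\<lambda>k. int (w ! k))),
      restrict (\<lambda>a. rep (syndrome \<beta> (h + a) (\<lambda>k. int (w ! k)))) A)" for w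
  define T where "T = Fq \<times> (A \<rightarrow>\<^sub>E range rep)"
  have finT: "finite T" unfolding T_def
    by (intro finite_cartesian_product finite_Fq finite_PiE) (auto simp: A_def finite_range_rep)
  have "card (words (n * t) p) \<le> card T * card (check_code h r)"
  proof (rule card_le_mult_fibres[where f = f])
    show "f ` words (n * t) p \<subseteq> T"
      by (auto simp: f_def T_def intro!: rep_in_Fq syndrome_shift_fixed[OF h] beta_fixed)
    fix b assume "b \<in> T"
    show "card {w \<in> words (n * t) p. f w = b} \<le> card (check_code h r)"
    proof (cases "{w \<in> words (n * t) p. f w = b} = {}")
      case True
      show ?thesis unfolding True by simp
    next
      case False
      then obtain v where v: "v \<in> words (n * t) p" "f v = b" by auto
      show ?thesis
      proof (rule card_inj_on_le[where f = "\<lambda>w. word_sub p w v"])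
        show "inj_on (\<lambda>w. word_sub p w v) {w \<in> words (n * t) p. f w = b}"
        proof (rule inj_onI)
          fix x y assume xy: "x \<in> {w \<in> words (n * t) p. f w = b}" "y \<in> {w \<in> words (n * t) p. f w = b}"
            "word_sub p x v = word_sub p y v"
          have "x = word_add p (word_sub p x v) v"
            using word_add_sub_cancel(1)[OF p_pos _ v(1), of x] xy by simp
          also have "\<dots> = y"
            using word_add_sub_cancel(1)[OF p_pos _ v(1), of y] xy by simp
          finally show "x = y" .
        qed
        show "(\<lambda>w. word_sub p w v) ` {w \<in> words (n * t) p. f w = b} \<subseteq> check_code h r"
        proof (rule image_subsetI)
          fix w assume w: "w \<in> {w \<in> words (n * t) p. f w = b}"
          then have ww: "w \<in> words (n * t) p" and fw: "f w = f v" using v by auto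
          have zeros: "syndrome \<beta> (h + a) (\<lambda>k. int (word_sub p w v ! k)) \<approx> 0"
            if a: "a \<le> r" "a = 0 \<or> \<not> q dvd a" for a
          proof -
            have "rep (syndrome \<beta> (h + a) (\<lambda>k. int (w ! k))) = rep (syndrome \<beta> (h + a) (\<lambda>k. int (v ! k)))"
            proof (cases "a = 0")
              case True
              moreover have "fst (f w) = fst (f v)" using fw by simp
              ultimately show ?thesis by (simp add: f_def)
            next
              case False
              then have "a \<in> A" using a by (auto simp: A_def)
              moreover have "snd (f w) a = snd (f v) a" using fw by simp
              ultimately show ?thesis by (simp add: f_def)
            qed
            then have "syndrome \<beta> (h + a) (\<lambda>k. int (w ! k)) - syndrome \<beta> (h + a) (\<lambda>k. int (v ! k)) \<approx> 0"
              by (simp add: rep_eq_iff eqv_diff_zero_iff)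
            then show ?thesis by (rule eqv_trans[OF syndrome_word_add(2)[OF ww v(1)]])
          qed
          have "syndrome \<beta> (h + a) (\<lambda>k. int (word_sub p w v ! k)) \<approx> 0" if "a \<le> r" for a
            by (rule syndrome_zero_multiples[OF h beta_fixed, where e = 0 and r = r]) (use zeros that in auto)
          then show "word_sub p w v \<in> check_code h r"
            using word_sub_in_words[OF p_pos ww v(1)] by (simp add: check_code_def)
        qed
        show "finite (check_code h r)" by (simp add: check_code_def)
      qed
    qed
  qed (simp_all add: finT)
  moreover have "card T = q * (q ^ m) ^ (r - r div q)"
    using card_non_multiples[of q r] q_gt_1 p_pos
    by (simp add: T_def card_cartesian_product card_Fq card_PiE A_def card_range_rep q_power_m)
  ultimately show ?thesis by (simp add: card_words)
qed

text \<open>A codeword is determined by the coefficients of its polynomial modulo the ideal, and of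
  the constant coefficient only the trace in \<open>Fq\<close> matters. Hence the exponent 0
  contributes \<open>q\<close> instead of \<open>q ^ m\<close>.\<close>

lemma card_trace_code:
  assumes e: "e \<le> 1"
  shows "card (trace_code e r) \<le> q ^ (1 - e) * (q ^ m) ^ (r - r div q)"
proof -
  define A where "A = {a \<in> {1..r}. \<not> q dvd a}"
  define E where "E = exponents e r"
  have E: "E = (if e = 0 then insert 0 A else A)"
    using e by (auto simp: E_def exponents_def A_def le_Suc_eq)
  have finA: "finite A" "0 \<notin> A" by (auto simp: A_def)
  define F where "F = (if e = 0 then Fq else {0})"
  define T where "T = F \<times> (A \<rightarrow>\<^sub>E range rep)"
  have finT: "finite T" unfolding T_def F_def
    by (intro finite_cartesian_product finite_PiE) (auto simp: A_def finite_range_rep finite_Fq)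
  have "\<forall>w. \<exists>l. w \<in> trace_code e r \<longrightarrow> encodes E l w" by (auto simp: trace_code_def E_def)
  then obtain l where l: "\<And>w. w \<in> trace_code e r \<Longrightarrow> encodes E (l w) w" by metis
  define f where "f w = ((if e = 0 then rep (tr q m (l w 0)) else 0), restrict (\<lambda>a. rep (l w a)) A)" for w
  have "card (trace_code e r) \<le> card T"
  proof (rule card_inj_on_le[OF _ _ finT])
    show "f ` trace_code e r \<subseteq> T"
      by (auto simp: f_def T_def F_def intro!: rep_in_Fq tr_q_fixed)
    show "inj_on f (trace_code e r)"
    proof (rule inj_onI)
      fix v w assume v: "v \<in> trace_code e r" and w: "w \<in> trace_code e r" and eq: "f v = f w"
      have lA: "l v a \<approx> l w a" if "a \<in> A" for a
      proof -
        have "snd (f v) a = snd (f w) a" using eq by simp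
        then show ?thesis using that by (simp add: f_def rep_eq_iff)
      qed
      have l0: "tr q m (l v 0) \<approx> tr q m (l w 0)" if "e = 0"
        using eq that by (auto simp: f_def rep_eq_iff)
      have summand: "tr q m (l v b * \<xi> i ^ b) \<approx> tr q m (l w b * \<xi> i ^ b)" if "b \<in> E" for b i
      proof (cases "b = 0")
        case True
        then have "e = 0" using that finA by (auto simp: E split: if_splits)
        then show ?thesis using l0 True by simp
      next
        case False
        then have "b \<in> A" using that by (auto simp: E split: if_splits)
        then show ?thesis by (intro tr_cong eqv_mult lA eqv_refl)
      qed
      have eval: "tr q m (eval_sum E (l v) i) \<approx> tr q m (eval_sum E (l w) i)" for i
      proof -
        have "tr q m (eval_sum E (l v) i) \<approx> (\<Sum>b\<in>E. tr q m (l v b * \<xi> i ^ b))"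
          unfolding eval_sum_def by (rule tr_sum[OF refl])
        also have "\<dots> \<approx> (\<Sum>b\<in>E. tr q m (l w b * \<xi> i ^ b))" by (intro eqv_sum summand)
        also have "\<dots> \<approx> tr q m (eval_sum E (l w) i)"
          unfolding eval_sum_def by (rule eqv_sym[OF tr_sum[OF refl]])
        finally show ?thesis .
      qed
      have vw: "v \<in> words (n * t) p" "w \<in> words (n * t) p" using v w by (auto simp: trace_code_def)
      have "v ! k = w ! k" if k: "k < n * t" for k
      proof -
        define i where "i = k div t"
        define s where "s = k mod t"
        have ks: "i < n" "s < t" "k = i * t + s"
          using k t_pos by (simp_all add: less_mult_imp_div_less i_def s_def)
        have "of_nat (v ! k) \<approx> tr p (t * m) (\<gamma> s * eval_sum E (l v) i)"
          using l[OF v] ks by (simp add: encodes_def)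
        also have "\<dots> \<approx> tr p t (\<gamma> s * tr q m (eval_sum E (l v) i))" by (rule tr_p_gamma) fact
        also have "\<dots> \<approx> tr p t (\<gamma> s * tr q m (eval_sum E (l w) i))"
          by (intro tr_cong eqv_mult eqv_refl eval)
        also have "\<dots> \<approx> tr p (t * m) (\<gamma> s * eval_sum E (l w) i)" by (rule eqv_sym[OF tr_p_gamma]) fact
        also have "\<dots> \<approx> of_nat (w ! k)"
          by (rule eqv_sym) (use l[OF w] ks in \<open>simp add: encodes_def\<close>)
        finally show ?thesis using vw k by (intro of_nat_eqv_imp_eq) (auto simp: words_iff)
      qed
      then show "v = w" using vw by (auto simp: words_iff list_eq_iff_nth_eq)
    qed
  qed
  also have "card T = q ^ (1 - e) * (q ^ m) ^ (r - r div q)"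
  proof -
    have "card F = q ^ (1 - e)" using e by (cases "e = 0") (simp_all add: F_def card_Fq)
    moreover have "card (A \<rightarrow>\<^sub>E range rep) = (q ^ m) ^ (r - r div q)"
      using card_non_multiples[of q r] p_pos by (simp add: card_PiE A_def card_range_rep q_power_m)
    ultimately show ?thesis by (simp add: T_def card_cartesian_product)
  qed
  finally show ?thesis .
qed

text \<open>The syndromes of \<open>w - a1\<close> and \<open>w - a2\<close> vanish, hence those of
  \<open>a1 - a2\<close>, whose support has at most \<open>2 * tx\<close> digits.\<close>

lemma check_code_flip_distance:
  assumes tx: "2 * tx \<le> r + 1"
    and a: "a1 \<in> words (n * t) p" "a2 \<in> words (n * t) p" "wt a1 \<le> tx" "wt a2 \<le> tx"
    and w: "w \<in> words (n * t) p" "word_sub p w a1 \<in> check_code h r" "word_sub p w a2 \<in> check_code h r"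
  shows "a1 = a2"
proof (rule words_eqI_dvd[OF a(1,2)])
  fix k assume k: "k < n * t"
  show "int p dvd int (a1 ! k) - int (a2 ! k)"
  proof (rule bch_bound[where B = \<beta> and r = "r + 1" and ?a0.0 = h and
      y = "\<lambda>k. int (a1 ! k) - int (a2 ! k)"])
    fix c s assume "(\<Sum>r<t. of_int (c r) * \<beta> r) \<approx> 0" "s < t"
    then show "int p dvd c s" by (intro basis_independent(1))
  next
    fix b assume "h \<le> b" "b < h + (r + 1)"
    then obtain a where b: "b = h + a" "a \<le> r" by (intro that[of "b - h"]) auto
    let ?S = "\<lambda>w. syndrome \<beta> b (\<lambda>k. int (w ! k))"
    have "?S a1 - ?S a2 \<approx> (?S w - ?S a2) - (?S w - ?S a1)" by simp
    also have "\<dots> \<approx> ?S (word_sub p w a2) - ?S (word_sub p w a1)"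
      by (intro eqv_diff eqv_sym[OF syndrome_word_add(2)] w a)
    also have "\<dots> \<approx> 0 - 0" using w b by (intro eqv_diff) (auto simp: check_code_def)
    finally show "syndrome \<beta> b (\<lambda>k. int (a1 ! k) - int (a2 ! k)) \<approx> 0" by (simp add: syndrome_diff)
  next
    show "card {k. k < n * t \<and> \<not> int p dvd int (a1 ! k) - int (a2 ! k)} \<le> r + 1"
      using card_support_diff_le[OF a(1,2)] a tx by linarith
  qed (rule k)
qed

text \<open>Testing \<open>b1 - b2\<close> against the words that encode the monomials
  \<open>\<mu> * X ^ b\<close> shows that the trace of \<open>\<mu>\<close> times its
  \<open>\<gamma>\<close>-syndrome vanishes for every \<open>\<mu>\<close>, so the syndrome does.
  The exponents \<open>e..r\<close> are \<open>r + 1 - e\<close> consecutive zeros.\<close>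

lemma trace_code_phase_distance:
  assumes e: "e \<le> 1" and tz: "2 * tz \<le> r + 1 - e"
    and b: "b1 \<in> words (n * t) p" "b2 \<in> words (n * t) p" "wt b1 \<le> tz" "wt b2 \<le> tz"
    and dot: "\<forall>z\<in>trace_code e r. word_dot b1 z mod p = word_dot b2 z mod p"
  shows "b1 = b2"
proof (rule words_eqI_dvd[OF b(1,2)])
  fix k assume k: "k < n * t"
  define y where "y k = int (b1 ! k) - int (b2 ! k)" for k
  have synd: "syndrome \<gamma> b y \<approx> 0" if bE: "b \<in> exponents e r" for b
  proof (rule tr_nondegenerate)
    fix \<mu> :: 'a
    define l where "l = (\<lambda>b'. if b' = b then \<mu> else 0)"
    have eval: "eval_sum (exponents e r) l i = \<mu> * \<xi> i ^ b" for i
    proof -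
      have "eval_sum (exponents e r) l i = (\<Sum>b'\<in>exponents e r. if b' = b then \<mu> * \<xi> i ^ b else 0)"
        unfolding eval_sum_def l_def by (intro sum.cong) auto
      also have "\<dots> = \<mu> * \<xi> i ^ b" using bE by (simp add: exponents_def)
      finally show ?thesis .
    qed
    obtain z where z: "z \<in> words (n * t) p" "encodes (exponents e r) l z" using encodes_exists by blast
    have "word_dot b1 z mod p = word_dot b2 z mod p" using z dot by (auto simp: trace_code_def)
    then have "int p dvd int (word_dot b1 z) - int (word_dot b2 z)"
      by (simp add: mod_eq_dvd_iff[symmetric] flip: zmod_int)
    also have "int (word_dot b1 z) - int (word_dot b2 z) = (\<Sum>k<n * t. y k * int (z ! k))"
      using b z by (simp add: word_dot_conv_sum[of _ "n * t"] words_iff y_def sum_subtractf left_diff_distrib)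
    finally have "of_int (\<Sum>k<n * t. y k * int (z ! k)) \<approx> 0" by (rule of_int_dvd_eqv_zero)
    then have zero: "(\<Sum>i<n. \<Sum>s<t. of_int (y (i * t + s)) * of_nat (z ! (i * t + s))) \<approx> 0"
      by (simp add: sum_lessThan_mult)
    have "tr p (t * m) (\<mu> * syndrome \<gamma> b y) =
        tr p (t * m) (\<Sum>i<n. \<Sum>s<t. of_int (y (i * t + s)) * (\<gamma> s * (\<mu> * \<xi> i ^ b)))"
      by (simp add: syndrome_def block_def sum_distrib_left sum_distrib_right mult_ac)
    also have "\<dots> \<approx> (\<Sum>i<n. tr p (t * m) (\<Sum>s<t. of_int (y (i * t + s)) * (\<gamma> s * (\<mu> * \<xi> i ^ b))))"
      by (rule tr_sum[of p 1]) simp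
    also have "\<dots> \<approx> (\<Sum>i<n. \<Sum>s<t. tr p (t * m) (of_int (y (i * t + s)) * (\<gamma> s * (\<mu> * \<xi> i ^ b))))"
      by (rule eqv_sum, rule tr_sum[of p 1]) simp
    also have "\<dots> \<approx> (\<Sum>i<n. \<Sum>s<t. of_int (y (i * t + s)) * of_nat (z ! (i * t + s)))"
    proof (intro eqv_sum)
      fix i s assume "i \<in> {..<n}" "s \<in> {..<t}"
      then have "of_nat (z ! (i * t + s)) \<approx> tr p (t * m) (\<gamma> s * (\<mu> * \<xi> i ^ b))"
        using z(2) unfolding encodes_def eval by auto
      then show "tr p (t * m) (of_int (y (i * t + s)) * (\<gamma> s * (\<mu> * \<xi> i ^ b))) \<approx>
          of_int (y (i * t + s)) * of_nat (z ! (i * t + s))"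
        by (rule eqv_trans[OF tr_of_int eqv_mult[OF eqv_refl eqv_sym]])
    qed
    also note zero
    finally show "tr p (t * m) (\<mu> * syndrome \<gamma> b y) \<approx> 0" .
  qed
  have "int p dvd y k"
  proof (rule bch_bound[where B = \<gamma> and r = "r + 1 - e" and ?a0.0 = e and y = y])
    fix c s assume "(\<Sum>r<t. of_int (c r) * \<gamma> r) \<approx> 0" "s < t"
    then show "int p dvd c s" by (intro basis_independent(2))
  next
    fix a assume a: "e \<le> a" "a < e + (r + 1 - e)"
    then have "a \<le> r" using e by auto
    have "syndrome \<gamma> (0 + a) y \<approx> 0"
      by (rule syndrome_zero_multiples[OF _ gamma_fixed e _ a(1), where h = 0 and r = r]) (use synd \<open>a \<le> r\<close> in \<open>auto simp: exponents_def\<close>)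
    then show "syndrome \<gamma> a y \<approx> 0" by simp
  next
    show "card {k. k < n * t \<and> \<not> int p dvd y k} \<le> r + 1 - e"
      using card_support_diff_le[OF b(1,2)] b tz unfolding y_def by linarith
  qed (rule k)
  then show "int p dvd int (b1 ! k) - int (b2 ! k)" by (simp add: y_def)
qed

text \<open>Counted in symbols of the field of order \<open>q\<close>, the checks remove at most
  \<open>N1\<close> from \<open>n\<close> and the trace code occupies at most \<open>N2\<close>; the
  remaining \<open>k\<close> symbols index the cosets.\<close>

theorem css_bch:
  assumes h: "n dvd h * (q - 1)" and e: "e \<le> 1"
    and orth: "\<And>a b j. a \<le> r1 \<Longrightarrow> e \<le> b \<Longrightarrow> b \<le> r2 \<Longrightarrow> j < m \<Longrightarrow> \<not> n dvd h + a + b * q ^ j"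
    and tx: "2 * tx \<le> r1 + 1" and tz: "2 * tz \<le> r2 + 1 - e"
    and k: "k + (1 + m * (r1 - r1 div q)) + ((1 - e) + m * (r2 - r2 div q)) \<le> n"
  shows "\<exists>Q. subspace_dim (t * n) p Q (p ^ (t * k)) \<and> corrects (t * n) p Q tx tz"
proof -
  define N1 where "N1 = 1 + m * (r1 - r1 div q)"
  define N2 where "N2 = (1 - e) + m * (r2 - r2 div q)"
  have c1: "p ^ (n * t) \<le> q ^ N1 * card (check_code h r1)"
    using card_check_code[OF h, of r1] by (simp add: N1_def power_add power_mult)
  have c2: "card (trace_code e r2) \<le> q ^ N2"
    using card_trace_code[OF e, of r2] by (simp add: N2_def power_add power_mult)
  have "q ^ N1 * (p ^ (t * k) * q ^ N2) = q ^ N1 * (q ^ k * q ^ N2)" by (simp only: power_mult)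
  also have "\<dots> = q ^ (k + N1 + N2)" by (simp only: power_add mult_ac)
  also have "\<dots> \<le> q ^ n" using q_gt_1 k by (intro power_increasing) (auto simp: N1_def N2_def)
  finally have "q ^ N1 * (p ^ (t * k) * q ^ N2) \<le> p ^ (n * t)"
    by (simp only: power_mult[symmetric] mult.commute[of n t])
  then have "q ^ N1 * (p ^ (t * k) * q ^ N2) \<le> q ^ N1 * card (check_code h r1)"
    using c1 by (rule le_trans)
  then have "p ^ (t * k) * q ^ N2 \<le> card (check_code h r1)" using p_pos by simp
  then have card: "p ^ (t * k) * card (trace_code e r2) \<le> card (check_code h r1)"
    using mult_le_mono2[OF c2] order.trans by blast
  have sub: "trace_code e r2 \<subseteq> check_code h r1" by (rule trace_code_subset_check_code[OF orth])
  have "\<exists>Q. subspace_dim (n * t) p Q (p ^ (t * k)) \<and> corrects (n * t) p Q tx tz"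
  proof (rule css_code_exists[OF p_pos _ sub])
    show "check_code h r1 \<subseteq> words (n * t) p" by (auto simp: check_code_def)
    show "trace_code e r2 \<noteq> {}" using encodes_exists by (fastforce simp: trace_code_def)
    show "word_add p x z \<in> check_code h r1" if "x \<in> check_code h r1" "z \<in> trace_code e r2" for x z
      using that sub by (intro check_code_add) auto
  qed (fact trace_code_add card check_code_flip_distance[OF tx] trace_code_phase_distance[OF e tz])+
  then show ?thesis by (simp add: mult.commute)
qed

end

section \<open>The code parameters\<close>

lemma (in field_tower) code_positions_exist:
  "\<exists>B C X. code_positions P p t m B C X (q ^ m - 1)"
proof -
  obtain B C where BC: "\<forall>s. B s ^ q \<approx> B s" "\<forall>s<t. C s ^ q \<approx> C s"
    "\<forall>s<t. \<forall>r<t. tr p t (C s * B r) \<approx> of_nat (of_bool (r = s))"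
    "\<forall>u. u ^ q \<approx> u \<longrightarrow> (\<exists>c. u \<approx> (\<Sum>s<t. of_nat (c s) * B s))"
    using dual_bases_exist by (elim exE conjE)
  obtain X where X: "bij_betw X {..<q ^ m - 1} (range rep - {rep 0})"
    using ex_bij_betw_nat_finite[of "range rep - {rep 0}"] finite_range_rep
    unfolding card_units atLeast0LessThan by auto
  have "code_positions_axioms P p t m B C X (q ^ m - 1)"
    unfolding code_positions_axioms_def using BC X by (intro conjI allI impI) simp_all
  then show ?thesis using field_tower_axioms by (auto simp: code_positions_def)
qed

lemma has_AQECC_css_bch:
  fixes K :: int
  assumes p: "prime p" and t: "t \<ge> 1" and m: "m \<ge> 1" and q: "q = p ^ t" and n: "n = q ^ m - 1"
    and h: "n dvd h * (q - 1)" and e: "e \<le> 1"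
    and orth: "\<And>a b j. a \<le> r1 \<Longrightarrow> e \<le> b \<Longrightarrow> b \<le> r2 \<Longrightarrow> j < m \<Longrightarrow> \<not> n dvd h + a + b * q ^ j"
    and dx: "2 * ((dx - 1) div 2) \<le> r1 + 1" and dz: "2 * ((dz - 1) div 2) \<le> r2 + 1 - e"
    and K: "0 \<le> K" "K + 1 + int m * int (r1 - r1 div q) + int (1 - e) + int m * int (r2 - r2 div q) \<le> int n"
  shows "has_AQECC (t * n) (int t * K) dz dx p"
proof -
  obtain P :: "int poly set" where "galois_cong P p (t * m)"
    using galois_cong_exists[OF p, of "t * m"] t m by auto
  then have "field_tower P p t m" by (simp add: field_tower_def)
  then obtain B C X where "code_positions P p t m B C X n"
    using field_tower.code_positions_exist n q by blast
  note css = code_positions.css_bch[OF this, folded q]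
  define k where "k = nat K"
  have "int (k + (1 + m * (r1 - r1 div q)) + ((1 - e) + m * (r2 - r2 div q))) \<le> int n"
    using K by (simp add: k_def)
  then have "k + (1 + m * (r1 - r1 div q)) + ((1 - e) + m * (r2 - r2 div q)) \<le> n"
    by (simp only: of_nat_le_iff)
  from css[OF h e orth dx dz this] obtain Q where
    "subspace_dim (t * n) p Q (p ^ (t * k))" "corrects (t * n) p Q ((dx - 1) div 2) ((dz - 1) div 2)"
    by blast
  moreover have "int (t * k) = int t * K" using K by (simp add: k_def)
  ultimately show ?thesis unfolding has_AQECC_def AQECC_def by blast
qed

text \<open>Keeps the claimed dimensions nonnegative: \<open>4 * q - 5\<close> is the largest
  multiplier of \<open>m\<close> in the five families, and 3 is the subtracted 2 plus the 1 in
  \<open>n = q ^ m - 1\<close>.\<close>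

lemma dimension_bound:
  fixes q m :: nat
  assumes "q \<ge> 3" "m \<ge> 3"
  shows "m * (4 * q - 5) + 3 \<le> q ^ m"
proof -
  define d where "d = 4 * q - 5"
  have base: "3 * d + 3 \<le> q ^ 3"
  proof (cases "q = 3")
    case True
    then show ?thesis by (simp add: d_def)
  next
    case False
    then have "q \<ge> 4" using assms(1) by simp
    then have "4 * 4 * q \<le> q * q * q" by (intro mult_le_mono) auto
    moreover have "3 * d + 3 \<le> 4 * 4 * q" using assms(1) unfolding d_def by simp
    ultimately show ?thesis unfolding power3_eq_cube by (rule le_trans[rotated])
  qed
  have "m * d + 3 \<le> q ^ m"
    using assms(2)
  proof (induction m rule: dec_induct)
    case base
    show ?case by (rule \<open>3 * d + 3 \<le> q ^ 3\<close>)
  next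
    case (step k)
    have "1 * d \<le> k * d" by (rule mult_le_mono1) (use step.hyps in linarith)
    then have "Suc k * d + 3 \<le> 2 * (k * d + 3)" unfolding mult_Suc add_mult_distrib2 by linarith
    also have "\<dots> \<le> q * q ^ k" by (rule mult_le_mono[OF _ step.IH]) (use assms in linarith)
    finally show ?case unfolding power_Suc .
  qed
  then show ?thesis unfolding d_def .
qed

text \<open>Multiplication by \<open>q\<close> turns \<open>q ^ (m - 1)\<close> into
  \<open>q ^ m\<close>, which is 1 modulo \<open>q ^ m - 1\<close>, and fixes \<open>h\<close>. The
  one conjugate too large for a direct size estimate becomes small.\<close>

lemma dvd_shift_power:
  fixes q m h a b :: nat
  assumes "m \<ge> 1" "q \<ge> 1" "q ^ m - 1 dvd h * (q - 1)" "q ^ m - 1 dvd h + a + b * q ^ (m - 1)"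
  shows "q ^ m - 1 dvd h + (q * a + b)"
proof -
  have "q ^ m - 1 dvd q * (h + a + b * q ^ (m - 1))" using assms(4) by (rule dvd_mult)
  also have "q * (h + a + b * q ^ (m - 1)) = (h * (q - 1) + b * (q ^ m - 1)) + (h + (q * a + b))"
  proof -
    have "q * q ^ (m - 1) = (q ^ m - 1) + 1" using assms(1,2) by (simp flip: power_Suc)
    then have "b * (q * q ^ (m - 1)) = b * (q ^ m - 1) + b" by (simp add: algebra_simps)
    moreover have "q * h = h * (q - 1) + h" using assms(2) by (cases q) auto
    ultimately show ?thesis by (simp add: algebra_simps)
  qed
  finally show ?thesis using assms(3) by (simp add: dvd_add_right_iff)
qed

text \<open>Positive because of \<open>b \<ge> 1\<close>, and below \<open>q ^ m - 1\<close>: for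
  \<open>j \<le> m - 2\<close> directly, for \<open>j = m - 1\<close> after a cyclic shift, where
  \<open>q * a + b \<le> 2 * q * q\<close>.\<close>

lemma exponents_orthogonal:
  fixes q m a b j :: nat
  assumes q: "q \<ge> 3" and m: "m \<ge> 3" and a: "a \<le> 2 * q - 2" and b: "1 \<le> b" "b \<le> 2 * q" and j: "j < m"
  shows "\<not> q ^ m - 1 dvd 0 + a + b * q ^ j"
proof
  assume dvd: "q ^ m - 1 dvd 0 + a + b * q ^ j"
  define Y where "Y = q ^ (m - 2)"
  have m2: "m = Suc (Suc (m - 2))" using m by simp
  have qm: "q ^ m = q * (q * Y)" unfolding Y_def by (subst m2) simp
  have "q ^ 1 \<le> q ^ (m - 2)" using q m by (intro power_increasing) auto
  then have Yq: "q \<le> Y" by (simp add: Y_def)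
  have qY: "3 * Y \<le> q * Y" "3 * (q * Y) \<le> q * (q * Y)" using q by auto
  show False
  proof (cases "j = m - 1")
    case True
    have "q ^ m - 1 dvd 0 + (q * a + b)"
      by (rule dvd_shift_power) (use m q dvd True in auto)
    then have "q ^ m - 1 \<le> q * a + b" using b by (intro dvd_imp_le) auto
    moreover have "q * a \<le> q * (2 * q - 2)" using a by (rule mult_le_mono2)
    moreover have "q * (2 * q - 2) + 2 * q = 2 * (q * q)" using q by (cases q) (auto simp: algebra_simps)
    moreover have "q * q \<le> q * Y" using Yq by simp
    ultimately show False using qm qY b Yq q by linarith
  next
    case False
    then have "b * q ^ j \<le> (2 * q) * Y"
      unfolding Y_def using b q j by (intro mult_le_mono power_increasing) auto
    moreover have "q ^ m - 1 \<le> 0 + a + b * q ^ j" using b q dvd by (intro dvd_imp_le) auto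
    moreover have "(2 * q) * Y = 2 * (q * Y)" by simp
    ultimately show False using qm qY a Yq q by linarith
  qed
qed

text \<open>After a cyclic shift if \<open>j = m - 1\<close>, the exponent is \<open>h + x\<close>
  with \<open>x < h\<close>, so it lies strictly between 0 and \<open>2 * h = q ^ m - 1\<close>.
  Both cases obey the same bound on \<open>x\<close> because
  \<open>q \<le> q ^ (m - 2)\<close>.\<close>

lemma exponents_orthogonal_half:
  fixes q m a b j h :: nat
  assumes q: "q \<ge> 1" and m: "m \<ge> 3" and h: "2 * h = q ^ m - 1" "q ^ m - 1 dvd h * (q - 1)"
    and B: "2 * (B + B * q ^ (m - 2)) + 1 < q ^ m" and a: "a \<le> B" and b: "b \<le> B" and j: "j < m"
  shows "\<not> q ^ m - 1 dvd h + a + b * q ^ j"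
proof
  assume dvd: "q ^ m - 1 dvd h + a + b * q ^ j"
  have "q ^ 1 \<le> q ^ (m - 2)" using q m by (intro power_increasing) auto
  then have Yq: "q \<le> q ^ (m - 2)" by simp
  have "\<exists>x. q ^ m - 1 dvd h + x \<and> x \<le> B + B * q ^ (m - 2)"
  proof (cases "j = m - 1")
    case True
    have "q ^ m - 1 dvd h + (q * a + b)"
      by (rule dvd_shift_power) (use m q dvd True h in auto)
    moreover have "q * a \<le> q ^ (m - 2) * B" using Yq a by (rule mult_le_mono)
    ultimately show ?thesis using b by (intro exI[of _ "q * a + b"]) (auto simp: mult.commute)
  next
    case False
    then have "b * q ^ j \<le> B * q ^ (m - 2)" using b q j by (intro mult_le_mono power_increasing) auto
    then show ?thesis using dvd a by (intro exI[of _ "a + b * q ^ j"]) (auto simp: add.assoc)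
  qed
  then obtain x where x: "q ^ m - 1 dvd h + x" "x \<le> B + B * q ^ (m - 2)" by blast
  have "h > 0" using h B by linarith
  then have "q ^ m - 1 \<le> h + x" using x(1) by (intro dvd_imp_le) auto
  moreover have "2 * x + 1 < q ^ m"
    by (rule le_less_trans[OF add_right_mono[OF mult_le_mono2[OF x(2)]] B])
  ultimately show False using h(1) by linarith
qed

theorem theorem12:
  fixes p t q m n :: nat
  assumes "prime p" and "odd p" and "t \<ge> 1" and "q = p ^ t"
    and "m \<ge> 3" and "q = 3 \<longrightarrow> m \<ge> 4" and "n = q ^ m - 1"
  shows
    "has_AQECC (t * n) (int t * (int n - int m * (4 * int q - 5) - 2)) (2 * q + 2) (2 * q) p
   \<and> (\<forall>c::nat. c \<le> q - 2 \<longrightarrow>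
        has_AQECC (t * n) (int t * (int n - int m * (4 * int q - int c - 5) - 2))
          (2 * q + 2) (2 * q - c) p)
   \<and> (\<forall>c l :: nat. 2 \<le> c \<and> c \<le> q \<and> l \<le> c - 2 \<longrightarrow>
        has_AQECC (t * n) (int t * (int n - int m * (2 * int c - int l - 4) - 2)) c (c - l) p)
   \<and> (\<forall>c l :: nat. q + 2 < c \<and> c \<le> 2 * q \<and> l + q + 3 \<le> c \<longrightarrow>
        has_AQECC (t * n) (int t * (int n - int m * (2 * int c - int l - 6) - 2)) c (c - l) p)
   \<and> (\<forall>l::nat. l \<le> q - 2 \<longrightarrow>
        has_AQECC (t * n) (int t * (int n - int m * (4 * int q - int l - 5) - 1))
          (2 * q + 1) (2 * q - l) p)"
proof -
  have odd_q: "odd q" using assms by simp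
  have "p > 1" using assms(1) by (rule prime_gt_1_nat)
  then have "q > 1" unfolding assms(4) using assms(3) by (intro one_less_power) auto
  then have q3: "q \<ge> 3" using odd_q by (metis One_nat_def Suc_1 Suc_leI even_numeral le_neq_implies_less numeral_3_eq_3)
  have m3: "m \<ge> 3" and n: "n = q ^ m - 1" using assms by simp_all
  have m1: "m \<ge> 1" using m3 by simp
  have dim: "int m * (4 * int q - 5) + 2 \<le> int n"
  proof -
    have "m * (4 * q - 5) + 2 \<le> n" using dimension_bound[OF q3 m3] n by linarith
    then have "int (m * (4 * q - 5) + 2) \<le> int n" by (simp only: of_nat_le_iff)
    then show ?thesis using q3 by (simp add: of_nat_diff)
  qed
  have dim_le: "0 \<le> int n - int m * u - 2" if "u \<le> 4 * int q - 5" for u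
    using dim mult_left_mono[OF that, of "int m"] by linarith
  note css = has_AQECC_css_bch[OF assms(1,3) m1 assms(4) n]
  note orth = exponents_orthogonal[OF q3 m3, folded n]
  \<comment> \<open>One construction for (1), (2) and (5). The check exponents
    \<open>0..2 * q - c - 2\<close> contain the positive multiple \<open>q\<close>, the trace
    exponents \<open>1..2 * q\<close> contain \<open>q\<close> and \<open>2 * q\<close>. The cost is
    \<open>1 + m * (2 * q - c - 3) + m * (2 * q - 2)\<close>, so already \<open>s = 1\<close> is
    attained.\<close>
  have upper: "has_AQECC (t * n) (int t * (int n - int m * (4 * int q - int c - 5) - s)) dz (2 * q - c) p"
    if c: "c \<le> q - 2" and s: "1 \<le> s" "s \<le> 2" and dz: "dz \<le> 2 * q + 2" for c dz s
  proof (rule css[where h = 0 and e = 1 and ?r1.0 = "2 * q - c - 2" and ?r2.0 = "2 * q"])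
    fix a b j assume "a \<le> 2 * q - c - 2" "1 \<le> b" "b \<le> 2 * q" "j < m"
    then show "\<not> n dvd 0 + a + b * q ^ j" by (intro orth) auto
  next
    have "(2 * q - c - 2) div q = 1" using c q3 by (intro div_nat_eqI) auto
    then have r: "int (2 * q - c - 2 - (2 * q - c - 2) div q) = 2 * int q - int c - 3"
      "int (2 * q - 2 * q div q) = 2 * int q - 2" using c q3 by (simp_all add: of_nat_diff)
    show "int n - int m * (4 * int q - int c - 5) - s + 1 + int m * int (2 * q - c - 2 - (2 * q - c - 2) div q)
        + int (1 - 1) + int m * int (2 * q - 2 * q div q) \<le> int n"
      unfolding r using s by (simp add: algebra_simps)
    show "0 \<le> int n - int m * (4 * int q - int c - 5) - s"
      using dim_le[of "4 * int q - int c - 5"] s by linarith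
  qed (use c q3 dz in auto)
  \<comment> \<open>Oddness of \<open>q\<close> makes both \<open>n\<close> and \<open>q - 1\<close>
    even, so the half shift exists and is fixed by multiplication by \<open>q\<close> modulo
    \<open>n\<close>.\<close>
  have two_h: "2 * (n div 2) = n" using odd_q n m3 q3 by simp
  have h: "n dvd n div 2 * (q - 1)"
  proof -
    obtain w where w: "q - 1 = 2 * w" using odd_q q3 by (metis dvdE odd_two_times_div_two_nat dvd_triv_left)
    have "n div 2 * (q - 1) = 2 * (n div 2) * w" unfolding w by (simp only: mult_ac)
    then show ?thesis unfolding two_h by simp
  qed
  define Y where "Y = q ^ (m - 2)"
  have Yq: "q \<le> Y"
  proof -
    have "q ^ 1 \<le> q ^ (m - 2)" using q3 m3 by (intro power_increasing) auto
    then show ?thesis by (simp add: Y_def)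
  qed
  have qm: "q ^ m = q * (q * Y)"
  proof -
    have "m = Suc (Suc (m - 2))" using m3 by simp
    then show ?thesis unfolding Y_def by (metis power_Suc)
  qed
  have orth_half: "\<not> n dvd n div 2 + a + b * q ^ j"
    if "2 * (B + B * Y) + 1 < q ^ m" "a \<le> B" "b \<le> B" "j < m" for a b j B
    by (rule exponents_orthogonal_half[where q = q and m = m and h = "n div 2", folded n Y_def])
       (use that q3 m3 two_h h in auto)
  \<comment> \<open>The cheap exponents \<open>h\<close> and \<open>0\<close> form singleton orbits
    under multiplication by \<open>q\<close> modulo \<open>n\<close>, one on each side, and together
    cost the \<open>- 2\<close>. The parameter \<open>u\<close> is 4 when no positive multiple of
    \<open>q\<close> is in range and 6 when each side contains one.\<close>
  have two_singletons: "has_AQECC (t * n) (int t * (int n - int m * (2 * int c - int l - u) - 2)) c (c - l) p"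
    if c: "2 \<le> c" "c \<le> 2 * q" "l \<le> c - 2" and B: "2 * (c - 2 + (c - 2) * Y) + 1 < q ^ m" and u: "2 * int c - int l - u \<le> 4 * int q - 5"
      and r: "int (c - l - 2 - (c - l - 2) div q) + int (c - 2 - (c - 2) div q) \<le> 2 * int c - int l - u" for c l u
  proof (rule css[OF h, where e = 0 and ?r1.0 = "c - l - 2" and ?r2.0 = "c - 2"])
    fix a b j assume "a \<le> c - l - 2" "0 \<le> b" "b \<le> c - 2" "j < m"
    then show "\<not> n dvd n div 2 + a + b * q ^ j" by (intro orth_half[OF B]) auto
  next
    show "int n - int m * (2 * int c - int l - u) - 2 + 1 + int m * int (c - l - 2 - (c - l - 2) div q)
        + int (1 - 0) + int m * int (c - 2 - (c - 2) div q) \<le> int n"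
      using mult_left_mono[OF r, of "int m"] by (simp add: distrib_left)
    show "0 \<le> int n - int m * (2 * int c - int l - u) - 2"
      by (rule dim_le) (rule u)
  qed (use c in auto)
  show ?thesis
  proof (intro conjI allI impI)
    show "has_AQECC (t * n) (int t * (int n - int m * (4 * int q - 5) - 2)) (2 * q + 2) (2 * q) p"
      using upper[of 0 2 "2 * q + 2"] by simp
    fix c :: nat assume "c \<le> q - 2"
    then show "has_AQECC (t * n) (int t * (int n - int m * (4 * int q - int c - 5) - 2)) (2 * q + 2) (2 * q - c) p"
      by (intro upper) auto
  next
    fix l :: nat assume "l \<le> q - 2"
    then show "has_AQECC (t * n) (int t * (int n - int m * (4 * int q - int l - 5) - 1)) (2 * q + 1) (2 * q - l) p"
      by (intro upper) auto
  next
    fix c l :: nat assume "2 \<le> c \<and> c \<le> q \<and> l \<le> c - 2"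
    then have c: "2 \<le> c" "c \<le> q" "l \<le> c - 2" by simp_all
    show "has_AQECC (t * n) (int t * (int n - int m * (2 * int c - int l - 4) - 2)) c (c - l) p"
    proof (rule two_singletons)
      \<comment> \<open>\<open>Z\<close>, \<open>W\<close>, \<open>V\<close> stand for
        \<open>(c - 2) * Y\<close>, \<open>q * Y\<close>, \<open>q ^ m\<close>, which makes the
        estimate linear; \<open>c \<le> q\<close> keeps the doubled sum below
        \<open>3 * W\<close>.\<close>
      have linear: "2 * (b + Z) + 1 < V" if "Z + 2 * Y \<le> W" "3 * W \<le> V" "q \<le> Y" "b + 2 \<le> q"
        for b Z W V using that unfolding add_mult_distrib2 by linarith
      have "(c - 2 + 2) * Y \<le> q * Y" by (rule mult_le_mono1) (use c in simp)
      then have "(c - 2) * Y + 2 * Y \<le> q * Y" unfolding add_mult_distrib .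
      moreover have "3 * (q * Y) \<le> q * (q * Y)" using q3 by simp
      ultimately show "2 * (c - 2 + (c - 2) * Y) + 1 < q ^ m" unfolding qm
        by (rule linear[OF _ _ Yq]) (use c in simp)
      show "int (c - l - 2 - (c - l - 2) div q) + int (c - 2 - (c - 2) div q) \<le> 2 * int c - int l - 4"
        using c by linarith
    qed (use c in auto)
  next
    fix c l :: nat assume "q + 2 < c \<and> c \<le> 2 * q \<and> l + q + 3 \<le> c"
    then have c: "q + 2 < c" "c \<le> 2 * q" "l + q + 3 \<le> c" by simp_all
    show "has_AQECC (t * n) (int t * (int n - int m * (2 * int c - int l - 6) - 2)) c (c - l) p"
    proof (cases "q = 3")
      case True
      \<comment> \<open>Here the shifted exponents can fail to be orthogonal, but \<open>c = 6\<close> is even, so one zero less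
        suffices on the phase side.\<close>
      then have cl: "c = 6" "l = 0" using c by auto
      show ?thesis
      \<comment> \<open>For \<open>m = 4\<close> the half shift does fail:
        \<open>40 + 4 + 4 * 9 = 80 = n\<close>. Phase distance 6 has radius 2, for which the four
        zeros \<open>1..4\<close> are enough; on each side 3 is free, so the cost is
        \<open>1 + 3 * m + 3 * m\<close>.\<close>
      proof (rule css[where h = 0 and e = 1 and ?r1.0 = 4 and ?r2.0 = 4])
        fix a b j :: nat assume "a \<le> 4" "1 \<le> b" "b \<le> 4" "j < m"
        then show "\<not> n dvd 0 + a + b * q ^ j" using True by (intro orth) auto
      next
        show "0 \<le> int n - int m * (2 * int c - int l - 6) - 2"
          by (rule dim_le) (use cl True in simp)
      qed (use cl True in auto)
    next
      case False
      then have q5: "q \<ge> 5" using q3 odd_q by presburger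
      have d: "(c - l - 2) div q = 1" "(c - 2) div q = 1" using c q3 by (auto intro!: div_nat_eqI)
      show ?thesis
      proof (rule two_singletons)
        \<comment> \<open>As before, but now \<open>c \<le> 2 * q\<close>: the doubled sum is about
          \<open>4 * W\<close>, which stays below \<open>q ^ m = q * W\<close> because
          \<open>q \<ge> 5\<close>.\<close>
        have linear: "2 * (b + Z) + 1 < V"
          if "Z + 2 * Y \<le> 2 * W" "5 * W \<le> V" "5 * Y \<le> W" "q \<le> Y" "b + 2 \<le> 2 * q"
          for b Z W V using that unfolding add_mult_distrib2 by linarith
        have "(c - 2 + 2) * Y \<le> 2 * q * Y" by (rule mult_le_mono1) (use c in simp)
        then have "(c - 2) * Y + 2 * Y \<le> 2 * (q * Y)" unfolding add_mult_distrib mult.assoc .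
        moreover have "5 * (q * Y) \<le> q * (q * Y)" "5 * Y \<le> q * Y" using q5 by simp_all
        ultimately show "2 * (c - 2 + (c - 2) * Y) + 1 < q ^ m" unfolding qm
          by (rule linear[OF _ _ _ Yq]) (use c in simp)
        show "int (c - l - 2 - (c - l - 2) div q) + int (c - 2 - (c - 2) div q) \<le> 2 * int c - int l - 6"
          unfolding d using c by linarith
      qed (use c in auto)
    qed
  qed
qed

end
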